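(* $\text{U}\exists\forall\text{-Sat}\in\mathbf{D_2^P}$ and $\text{WDom-Strategy}\in\mathbf{D_2^P}$.
   Context: $\Vert$ denotes concatenation of bit strings; circuit outputs are compared as binary numbers. $\mathbf{D_2^P}=\{L_1\cap L_2: L_1\in\mathbf{\Sigma_2^P},\ L_2\in\mathbf{\Pi_2^P}\}$. U$\exists\forall$-Sat: the input consists of two sets $\mathcal{X}=\{x_1,\dots,x_n\}$ and $\mathcal{Y}=\{y_1,\dots,y_n\}$ of Boolean variables and a Boolean formula $\psi$ over $\mathcal{X}\cup\mathcal{Y}$; the question is whether there is exactly one $x^*\in\{0,1\}^n$ such that for all $y'\in\{0,1\}^n$ we have $\psi(x^*\Vert y')=1$. WDom-Strategy (Weak-Dominant-Strategy): the input is a Boolean circuit $C\colon\{0,1\}^{2n}\to\{0,1\}^n$; the question is whether there exists $x\in\{0,1\}^n$ such that for all $x',y\in\{0,1\}^n$ with $x'\neq x$ there exists $y'\in\{0,1\}^n$ with $C(x\Vert y)\geq C(x'\Vert y)$ and $C(x\Vert y')>C(x'\Vert y')$. *)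

theory Defs
  imports Main "HOL-Computational_Algebra.Polynomial"
begin

section \<open>Deterministic multi-tape Turing machines\<close>

datatype move = MoveLeft | Stay | MoveRight

text \<open>
  States and tape symbols are initial segments of the natural numbers. Symbol 0 is the blank,
  symbols 1 and 2 represent the bits 0 and 1. The transition function maps a state and the list of
  scanned symbols (one for each tape) to the next state and, for each tape, the symbol to be
  written and the head movement.
\<close>

record tm =
  tapes :: nat
  symbols :: nat
  states :: nat
  start :: nat
  accept :: nat
  reject :: nat
  trans :: "nat \<Rightarrow> nat list \<Rightarrow> nat \<times> (nat \<times> move) list"

definition wf_tm :: "tm \<Rightarrow> bool" where
  "wf_tm M \<longleftrightarrow>
     1 \<le> tapes M \<and> 3 \<le> symbols M \<and>
     start M < states M \<and> accept M < states M \<and> reject M < states M \<and> accept M \<noteq> reject M \<and>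
     (\<forall>q < states M. \<forall>ss. length ss = tapes M \<and> set ss \<subseteq> {..<symbols M} \<longrightarrow>
        fst (trans M q ss) < states M \<and>
        length (snd (trans M q ss)) = tapes M \<and>
        fst ` set (snd (trans M q ss)) \<subseteq> {..<symbols M})"

text \<open>Tapes are infinite in both directions; a tape is given by its contents and head position.\<close>

type_synonym tape = "(int \<Rightarrow> nat) \<times> int"
type_synonym config = "nat \<times> tape list"

definition scan :: "tape \<Rightarrow> nat" where
  "scan tp = fst tp (snd tp)"

definition head_shift :: "move \<Rightarrow> int" where
  "head_shift d = (case d of MoveLeft \<Rightarrow> -1 | Stay \<Rightarrow> 0 | MoveRight \<Rightarrow> 1)"

definition act :: "nat \<times> move \<Rightarrow> tape \<Rightarrow> tape" where
  "act a tp = ((fst tp)(snd tp := fst a), snd tp + head_shift (snd a))"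

definition step :: "tm \<Rightarrow> config \<Rightarrow> config" where
  "step M c =
     (if fst c = accept M \<or> fst c = reject M then c
      else let r = trans M (fst c) (map scan (snd c))
           in (fst r, map2 act (snd r) (snd c)))"

definition bit_symbol :: "bool \<Rightarrow> nat" where
  "bit_symbol b = (if b then 2 else 1)"

definition blank_tape :: tape where
  "blank_tape = ((\<lambda>_. 0), 0)"

definition input_tape :: "bool list \<Rightarrow> tape" where
  "input_tape w =
     ((\<lambda>i. if 0 \<le> i \<and> i < int (length w) then bit_symbol (w ! nat i) else 0), 0)"

definition init_config :: "tm \<Rightarrow> bool list \<Rightarrow> config" where
  "init_config M w = (start M, input_tape w # replicate (tapes M - 1) blank_tape)"

section \<open>Complexity classes\<close>

definition decides_in_time :: "tm \<Rightarrow> bool list set \<Rightarrow> (nat \<Rightarrow> nat) \<Rightarrow> bool" where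
  "decides_in_time M L T \<longleftrightarrow>
     (\<forall>w. \<exists>t \<le> T (length w).
        fst ((step M ^^ t) (init_config M w)) = (if w \<in> L then accept M else reject M))"

definition class_P :: "bool list set set" where
  "class_P = {L. \<exists>M (p :: nat poly). wf_tm M \<and> decides_in_time M L (poly p)}"

text \<open>
  The usual encoding of tuples of bit strings by a single bit string: every bit is doubled, and
  each component is terminated by 01.
\<close>

definition tuple :: "bool list list \<Rightarrow> bool list" where
  "tuple ws = concat (map (\<lambda>w. concat (map (\<lambda>b. [b, b]) w) @ [False, True]) ws)"

definition Sigma2P :: "bool list set set" where
  "Sigma2P = {L. \<exists>K \<in> class_P. \<exists>p :: nat poly. \<forall>w.
     w \<in> L \<longleftrightarrow>
       (\<exists>u. length u = poly p (length w) \<and>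
         (\<forall>v. length v = poly p (length w) \<longrightarrow> tuple [w, u, v] \<in> K))}"

definition Pi2P :: "bool list set set" where
  "Pi2P = {L. - L \<in> Sigma2P}"

definition D2P :: "bool list set set" where
  "D2P = {L1 \<inter> L2 | L1 L2. L1 \<in> Sigma2P \<and> L2 \<in> Pi2P}"

section \<open>Unique exists-forall satisfiability\<close>

text \<open>
  Formulas over \<open>{x\<^sub>1, \<dots>, x\<^sub>n} \<union> {y\<^sub>1, \<dots>, y\<^sub>n}\<close>: variable \<open>x\<^sub>i\<close> is \<open>Var (i - 1)\<close>, and
  \<open>y\<^sub>i\<close> is \<open>Var (n + i - 1)\<close>, so that an assignment is the concatenation \<open>x @ y\<close>.
\<close>

datatype formula =
    Var nat
  | Const bool
  | Neg formula
  | Conj formula formula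
  | Disj formula formula

primrec vars :: "formula \<Rightarrow> nat set" where
  "vars (Var i) = {i}"
| "vars (Const b) = {}"
| "vars (Neg f) = vars f"
| "vars (Conj f g) = vars f \<union> vars g"
| "vars (Disj f g) = vars f \<union> vars g"

primrec eval_formula :: "formula \<Rightarrow> bool list \<Rightarrow> bool" where
  "eval_formula (Var i) a = a ! i"
| "eval_formula (Const b) a = b"
| "eval_formula (Neg f) a = (\<not> eval_formula f a)"
| "eval_formula (Conj f g) a = (eval_formula f a \<and> eval_formula g a)"
| "eval_formula (Disj f g) a = (eval_formula f a \<or> eval_formula g a)"

text \<open>
  Instances are encoded by bit strings. Numbers are written in unary: as the sets of variables and
  the gates of a circuit are listed explicitly in the input, this changes the length of the input
  only polynomially. Formulas are written in postfix notation.
\<close>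

definition unary :: "nat \<Rightarrow> bool list" where
  "unary n = replicate n True @ [False]"

primrec encode_formula :: "formula \<Rightarrow> bool list" where
  "encode_formula (Var i) = [False, False, False] @ unary i"
| "encode_formula (Const b) = [False, True, b]"
| "encode_formula (Neg f) = encode_formula f @ [True, False, False]"
| "encode_formula (Conj f g) = encode_formula f @ encode_formula g @ [True, True, False]"
| "encode_formula (Disj f g) = encode_formula f @ encode_formula g @ [True, True, True]"

definition encode_sat_instance :: "nat \<Rightarrow> formula \<Rightarrow> bool list" where
  "encode_sat_instance n f = unary n @ encode_formula f"

definition UEA_Sat :: "bool list set" where
  "UEA_Sat = {encode_sat_instance n f | n f.
     vars f \<subseteq> {..<2 * n} \<and>
     (\<exists>!x. length x = n \<and> (\<forall>y. length y = n \<longrightarrow> eval_formula f (x @ y)))}"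

section \<open>Weakly dominant strategies\<close>

text \<open>
  A circuit with \<open>m\<close> inputs has the wires \<open>0, \<dots>, m - 1\<close> (the inputs) and \<open>m + j\<close> (the value of
  the \<open>j\<close>-th gate, counted from 0). Gates refer to earlier wires only.
\<close>

datatype gate =
    GConst bool
  | GNot nat
  | GAnd nat nat
  | GOr nat nat

datatype circuit = Circuit (gates: "gate list") (outputs: "nat list")

primrec gate_args :: "gate \<Rightarrow> nat set" where
  "gate_args (GConst b) = {}"
| "gate_args (GNot i) = {i}"
| "gate_args (GAnd i j) = {i, j}"
| "gate_args (GOr i j) = {i, j}"

definition is_circuit :: "nat \<Rightarrow> nat \<Rightarrow> circuit \<Rightarrow> bool" where
  "is_circuit m k C \<longleftrightarrow>
     (\<forall>j < length (gates C). gate_args (gates C ! j) \<subseteq> {..<m + j}) \<and>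
     length (outputs C) = k \<and> set (outputs C) \<subseteq> {..<m + length (gates C)}"

primrec eval_gate :: "gate \<Rightarrow> bool list \<Rightarrow> bool" where
  "eval_gate (GConst b) ws = b"
| "eval_gate (GNot i) ws = (\<not> ws ! i)"
| "eval_gate (GAnd i j) ws = (ws ! i \<and> ws ! j)"
| "eval_gate (GOr i j) ws = (ws ! i \<or> ws ! j)"

definition eval_circuit :: "circuit \<Rightarrow> bool list \<Rightarrow> bool list" where
  "eval_circuit C a =
     (let ws = foldl (\<lambda>ws g. ws @ [eval_gate g ws]) a (gates C)
      in map (\<lambda>i. ws ! i) (outputs C))"

text \<open>The most significant bit comes first, whereas \<open>horner_sum\<close> starts with the least one.\<close>

definition bin_val :: "bool list \<Rightarrow> nat" where
  "bin_val bs = horner_sum of_bool 2 (rev bs)"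

definition circuit_val :: "circuit \<Rightarrow> bool list \<Rightarrow> nat" where
  "circuit_val C a = bin_val (eval_circuit C a)"

primrec encode_gate :: "gate \<Rightarrow> bool list" where
  "encode_gate (GConst b) = [False, False, b]"
| "encode_gate (GNot i) = [False, True] @ unary i"
| "encode_gate (GAnd i j) = [True, False] @ unary i @ unary j"
| "encode_gate (GOr i j) = [True, True] @ unary i @ unary j"

definition encode_circuit :: "nat \<Rightarrow> circuit \<Rightarrow> bool list" where
  "encode_circuit n C =
     unary n @ concat (map (\<lambda>g. True # encode_gate g) (gates C)) @ [False] @
     concat (map unary (outputs C))"

definition WDom_Strategy :: "bool list set" where
  "WDom_Strategy = {encode_circuit n C | n C.
     is_circuit (2 * n) n C \<and>
     (\<exists>x. length x = n \<and>
       (\<forall>x' y. length x' = n \<and> length y = n \<and> x' \<noteq> x \<longrightarrow>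
         (\<exists>y'. length y' = n \<and>
            circuit_val C (x @ y) \<ge> circuit_val C (x' @ y) \<and>
            circuit_val C (x @ y') > circuit_val C (x' @ y'))))}"

section \<open>The encodings are injective\<close>

lemma unary_append_eq [simp]: "unary m @ r = unary n @ s \<longleftrightarrow> m = n \<and> r = s"
proof (induction m arbitrary: n)
  case 0
  then show ?case by (cases n) (auto simp: unary_def)
next
  case (Suc m)
  then show ?case by (cases n) (auto simp: unary_def)
qed

text \<open>Parsing postfix notation with a stack of formulas.\<close>

inductive reads :: "formula list \<Rightarrow> bool list \<Rightarrow> formula list \<Rightarrow> bool" where
  "reads s [] s"
| "reads (Var i # s) w t \<Longrightarrow> reads s ([False, False, False] @ unary i @ w) t"
| "reads (Const b # s) w t \<Longrightarrow> reads s ([False, True, b] @ w) t"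
| "reads (Neg f # s) w t \<Longrightarrow> reads (f # s) ([True, False, False] @ w) t"
| "reads (Conj f g # s) w t \<Longrightarrow> reads (g # f # s) ([True, True, False] @ w) t"
| "reads (Disj f g # s) w t \<Longrightarrow> reads (g # f # s) ([True, True, True] @ w) t"

lemma reads_encode_formula: "reads (f # s) w t \<Longrightarrow> reads s (encode_formula f @ w) t"
proof (induction f arbitrary: s w)
  case (Neg f) then show ?case using reads.intros(4)[of f s w t] by simp
next
  case (Conj f g) then show ?case using reads.intros(5)[of f g s w t] by simp
next
  case (Disj f g) then show ?case using reads.intros(6)[of f g s w t] by simp
qed (use reads.intros(2,3) in auto)

inductive_simps reads_simps:
  "reads s [] t"
  "reads s (False # False # False # w) t"
  "reads s (False # True # b # w) t"
  "reads s (True # False # False # w) t"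
  "reads s (True # True # False # w) t"
  "reads s (True # True # True # w) t"

lemma reads_deterministic: "reads s w t \<Longrightarrow> reads s w t' \<Longrightarrow> t = t'"
proof (induction arbitrary: t' rule: reads.induct)
  case (2 i s w t)
  from "2.prems" have "reads (Var i # s) w t'" by (auto simp: reads_simps)
  then show ?case by (rule "2.IH")
qed (simp_all add: reads_simps)

lemma encode_formula_inj: "inj encode_formula"
proof (rule injI)
  fix f g assume eq: "encode_formula f = encode_formula g"
  have "reads [] (encode_formula h) [h]" for h
    using reads_encode_formula[of h "[]" "[]" "[h]"] reads.intros(1) by simp
  then show "f = g"
    using reads_deterministic eq by (metis list.inject)
qed

lemma encode_sat_instance_inj:
  "encode_sat_instance m f = encode_sat_instance n g \<longleftrightarrow> m = n \<and> f = g"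
  using encode_formula_inj by (auto simp: encode_sat_instance_def dest: injD)

lemma encode_gate_append_eq: "encode_gate g @ r = encode_gate h @ s \<longleftrightarrow> g = h \<and> r = s"
  by (cases g; cases h) auto

lemma encode_gates_append_eq:
  "concat (map (\<lambda>g. True # encode_gate g) gs) @ False # r =
   concat (map (\<lambda>g. True # encode_gate g) hs) @ False # s \<longleftrightarrow> gs = hs \<and> r = s"
proof (induction gs arbitrary: hs)
  case Nil
  then show ?case by (cases hs) auto
next
  case (Cons g gs)
  then show ?case by (cases hs) (auto simp: encode_gate_append_eq)
qed

lemma unary_not_Nil: "unary n \<noteq> []"
  by (simp add: unary_def)

lemma encode_outputs_eq: "concat (map unary is) = concat (map unary js) \<longleftrightarrow> is = js"
proof (induction "is" arbitrary: js)
  case Nil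
  then show ?case by (cases js) (auto simp: unary_not_Nil)
next
  case (Cons i "is")
  then show ?case by (cases js) (auto simp: unary_not_Nil)
qed

lemma encode_circuit_inj: "encode_circuit m C = encode_circuit n D \<longleftrightarrow> m = n \<and> C = D"
  by (cases C; cases D)
    (auto simp: encode_circuit_def encode_gates_append_eq encode_outputs_eq)

lemma bin_val_snoc: "bin_val (bs @ [b]) = 2 * bin_val bs + of_bool b"
  by (simp add: bin_val_def)

end

theory Submission
  imports Defs
begin

text \<open>
  Both problems ask whether exactly one \<open>x\<close> has a certain coNP property \<open>S\<close>: a weakly dominant
  strategy is the same as a unique strategy that is nowhere worse than any other. There is exactly
  one such \<open>x\<close> iff \<open>\<exists>x. S x\<close> holds, but \<open>\<exists>x1 x2. x1 \<noteq> x2 \<and> S x1 \<and> S x2\<close> does not; both of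
  these statements are in \<open>\<Sigma>\<^sub>2P\<close>. The polynomial-time relation below the quantifiers is decided by a
  five-tape machine that evaluates the formula or circuit on all assignments in question
  simultaneously, with tuples of bits as tape symbols.
\<close>

section \<open>Machines over finite types of states and symbols\<close>

text \<open>Weak dominance as stated has the quantifier prefix \<exists>\<forall>\<exists>; passing
  to uniqueness removes the innermost quantifier, which brings the problem down to the second level.
  The other obstacle is the machine model: \<open>class_P\<close> asks for a concrete transition
  table over numbers that halts in polynomial time on every bit string, including those that are no
  tuples or encode no instance. Parsing is therefore part of the evaluation, and a word is accepted
  only if it is an encoding. One left-to-right pass over the formula or circuit suffices, because
  formulas are postfix and gates refer to earlier wires only. The flags \<open>sat\<close> and
  \<open>differ\<close> select among four verifiers, so that the machine is analysed once.
  \<open>Sigma2P\<close> prescribes the exact length of the certificates, whereas \<open>n\<close>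
  depends on the instance; both certificates thus have length \<open>2 * length w\<close>, with room
  for two padded words of length \<open>n \<le> length w\<close>, and the padding does not influence
  the verdict.\<close>

datatype 'v sym = Blank | Mark | Bit bool | Val 'v

lemma finite_UNIV_cover: "finite A \<Longrightarrow> (\<And>x :: 'a. x \<in> A) \<Longrightarrow> finite (UNIV :: 'a set)"
  by (rule finite_subset) auto

instance sym :: (finite) finite
proof (intro_classes, rule finite_UNIV_cover)
  show "finite ({Blank, Mark} \<union> range Bit \<union> range Val :: ('a :: finite) sym set)"
    by simp
  show "x \<in> {Blank, Mark} \<union> range Bit \<union> range Val" for x :: "('a :: finite) sym"
    by (cases x) auto
qed

text \<open>
  A tape is a pair of lists: the cells to the left of the head, nearest first, and the cells from
  the head on to the right; beyond the lists, all cells are blank.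
\<close>

type_synonym 'v ztape = "'v sym list \<times> 'v sym list"

fun hdb :: "'v sym list \<Rightarrow> 'v sym" where
  "hdb [] = Blank"
| "hdb (x # xs) = x"

definition nthb :: "'v sym list \<Rightarrow> nat \<Rightarrow> 'v sym" where
  "nthb xs k = (if k < length xs then xs ! k else Blank)"

text \<open>Dropping a blank in front of the empty list keeps blank tapes in the form
  \<open>([], [])\<close>, so that configurations can be described by plain equations.\<close>

definition bcons :: "'v sym \<Rightarrow> 'v sym list \<Rightarrow> 'v sym list" where
  "bcons x xs = (if x = Blank \<and> xs = [] then [] else x # xs)"

lemma bcons_simps [simp]:
  "bcons Mark xs = Mark # xs" "bcons (Bit b) xs = Bit b # xs" "bcons (Val v) xs = Val v # xs"
  "bcons x (y # ys) = x # y # ys" "bcons Blank [] = []"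
  by (auto simp: bcons_def)

fun upd :: "'v sym \<Rightarrow> 'v sym list \<Rightarrow> 'v sym list" where
  "upd x [] = (if x = Blank then [] else [x])"
| "upd x (y # ys) = x # ys"

fun zact :: "'v sym \<times> move \<Rightarrow> 'v ztape \<Rightarrow> 'v ztape" where
  "zact (x, MoveLeft) (l, r) = (tl l, bcons (hdb l) (upd x r))"
| "zact (x, Stay) (l, r) = (l, upd x r)"
| "zact (x, MoveRight) (l, r) = (bcons x l, tl r)"

lemma upd_hdb [simp]: "upd (hdb r) r = r"
  by (cases r) auto

text \<open>As a simplification rule it disposes of the tapes that a transition leaves
  alone.\<close>

lemma zact_stay [simp]: "zact (hdb (snd z), Stay) z = z"
  by (cases z) auto

lemma hdb_conv_nthb: "hdb xs = nthb xs 0"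
  by (cases xs) (auto simp: nthb_def)

lemma nthb_tl: "nthb (tl xs) k = nthb xs (Suc k)"
  by (cases xs) (auto simp: nthb_def)

lemma nthb_bcons: "nthb (bcons x xs) k = (case k of 0 \<Rightarrow> x | Suc j \<Rightarrow> nthb xs j)"
  by (auto simp: nthb_def bcons_def split: nat.split)

lemma nthb_upd: "nthb (upd x xs) k = (case k of 0 \<Rightarrow> x | Suc j \<Rightarrow> nthb xs (Suc j))"
  by (cases xs) (auto simp: nthb_def split: nat.split)

section \<open>Correspondence between list tapes and tapes over the integers\<close>

definition represents :: "('v sym \<Rightarrow> nat) \<Rightarrow> 'v ztape \<Rightarrow> tape \<Rightarrow> bool" where
  "represents e z tp \<longleftrightarrow>
     (\<forall>i. fst tp (snd tp + i) =
        e (if 0 \<le> i then nthb (snd z) (nat i) else nthb (fst z) (nat (- 1 - i))))"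

lemma represents_scan: "represents e z tp \<Longrightarrow> scan tp = e (hdb (snd z))"
  by (auto simp: represents_def scan_def hdb_conv_nthb dest: spec[of _ 0])

text \<open>Positions are relative to the head, so a move shifts every index by one; only the cells
  next to the old and the new head position need separate cases.\<close>

lemma represents_act:
  assumes "represents e z tp"
  shows "represents e (zact (x, d) z) (act (e x, d) tp)"
proof -
  obtain l r where z: "z = (l, r)" by fastforce
  obtain f p where tp: "tp = (f, p)" by fastforce
  have f: "f (p + i) = e (if 0 \<le> i then nthb r (nat i) else nthb l (nat (- 1 - i)))" for i
    using assms by (auto simp: represents_def z tp)
  have nat_Suc: "nat i = Suc (nat (i - 1))" if "i > 0" for i
    using that by simp
  show ?thesis
  proof (cases d)
    case MoveLeft
    have "(f(p := e x)) (p - 1 + i) =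
        e (if 0 \<le> i then nthb (bcons (hdb l) (upd x r)) (nat i) else nthb (tl l) (nat (- 1 - i)))" for i
    proof -
      consider "i = 0" | "i = 1" | "i > 1" | "i < 0" by linarith
      then show ?thesis
      proof cases
        case 3
        then have "nat i = Suc (Suc (nat (i - 2)))" "nat (i - 1) = Suc (nat (i - 2))" by auto
        then show ?thesis using 3 f[of "i - 1"]
          by (auto simp: nthb_bcons nthb_upd algebra_simps)
      next
        case 4
        then have "nat (- i) = Suc (nat (- 1 - i))" by auto
        then show ?thesis using 4 f[of "i - 1"]
          by (auto simp: nthb_tl algebra_simps)
      qed (use f[of "-1"] in \<open>auto simp: nthb_bcons nthb_upd hdb_conv_nthb\<close>)
    qed
    then show ?thesis
      by (simp add: represents_def act_def head_shift_def z tp MoveLeft algebra_simps)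
  next
    case Stay
    have "(f(p := e x)) (p + i) =
        e (if 0 \<le> i then nthb (upd x r) (nat i) else nthb l (nat (- 1 - i)))" for i
      using f[of i] nat_Suc[of i]
      by (cases "i > 0") (auto simp: nthb_upd split: nat.split)
    then show ?thesis
      by (simp add: represents_def act_def head_shift_def z tp Stay)
  next
    case MoveRight
    have "(f(p := e x)) (p + 1 + i) =
        e (if 0 \<le> i then nthb (tl r) (nat i) else nthb (bcons x l) (nat (- 1 - i)))" for i
    proof -
      consider "i \<ge> 0" | "i = -1" | "i < -1" by linarith
      then show ?thesis
      proof cases
        case 1
        then have "nat (1 + i) = Suc (nat i)" by auto
        then show ?thesis using 1 f[of "1 + i"]
          by (auto simp: nthb_tl algebra_simps)
      next
        case 3
        then have "nat (- 1 - i) = Suc (nat (- i - 2))" by auto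
        then show ?thesis using 3 f[of "1 + i"]
          by (auto simp: nthb_bcons algebra_simps)
      qed (auto simp: nthb_bcons)
    qed
    then show ?thesis
      by (simp add: represents_def act_def head_shift_def z tp MoveRight algebra_simps)
  qed
qed

section \<open>Machines with typed states and their translation into numbered ones\<close>

locale machine =
  fixes \<delta> :: "'q :: finite \<Rightarrow> ('v :: finite) sym list \<Rightarrow> 'q \<times> ('v sym \<times> move) list"
    and k :: nat and q0 acc rej :: 'q
  assumes k_pos: "1 \<le> k"
    and acc_neq_rej: "acc \<noteq> rej"
    and length_actions: "length ss = k \<Longrightarrow> length (snd (\<delta> q ss)) = k"
begin

definition nxt :: "'q \<times> 'v ztape list \<Rightarrow> 'q \<times> 'v ztape list" where
  "nxt c = (if fst c = acc \<or> fst c = rej then c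
     else let r = \<delta> (fst c) (map (hdb \<circ> snd) (snd c)) in (fst r, map2 zact (snd r) (snd c)))"

definition initial :: "bool list \<Rightarrow> 'q \<times> 'v ztape list" where
  "initial w = (q0, ([], map Bit w) # replicate (k - 1) ([], []))"

text \<open>Here \<open>t\<close> is an upper bound, so time bounds may be enlarged freely;
  \<open>b\<close> is the verdict.\<close>

definition halts :: "'q \<times> 'v ztape list \<Rightarrow> nat \<Rightarrow> bool \<Rightarrow> bool" where
  "halts c t b \<longleftrightarrow> (\<exists>t' \<le> t. fst ((nxt ^^ t') c) = (if b then acc else rej))"

definition language :: "bool list set" where
  "language = {w. \<exists>t. halts (initial w) t True}"

lemma nxt_halted: "fst c = acc \<or> fst c = rej \<Longrightarrow> (nxt ^^ t) c = c"
  by (induction t) (auto simp: nxt_def)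

text \<open>Halting states are fixed points of \<open>nxt\<close>, so of two halting times the later
  one shows the same state as the earlier one.\<close>

lemma halts_deterministic:
  assumes "halts c t b" "halts c t' b'"
  shows "b = b'"
proof -
  have stable: "fst ((nxt ^^ n) c) = fst ((nxt ^^ m) c)"
    if "m \<le> n" "fst ((nxt ^^ m) c) = acc \<or> fst ((nxt ^^ m) c) = rej" for m n
    using nxt_halted[OF that(2), of "n - m"] that(1)
    by (metis comp_apply funpow_add le_add_diff_inverse2)
  obtain m m' where "fst ((nxt ^^ m) c) = (if b then acc else rej)"
    "fst ((nxt ^^ m') c) = (if b' then acc else rej)"
    using assms by (auto simp: halts_def)
  then show ?thesis
    using stable[of m m'] stable[of m' m] acc_neq_rej linear[of m m']
    by (auto split: if_splits)
qed

lemma halts_language: "halts (initial w) t b \<Longrightarrow> w \<in> language \<longleftrightarrow> b"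
  by (auto simp: language_def dest: halts_deterministic)

lemma halts_mono: "halts c t b \<Longrightarrow> t \<le> t' \<Longrightarrow> halts c t' b"
  unfolding halts_def using le_trans by blast

text \<open>The machine is analysed backwards with this rule: a verdict and a time bound for a later
  configuration are carried over to an earlier one. The final configuration never has to be
  described.\<close>

lemma halts_steps:
  assumes "(nxt ^^ m) c = c'" "halts c' t b" "m + t \<le> t'"
  shows "halts c t' b"
proof -
  obtain s where "s \<le> t" "fst ((nxt ^^ s) c') = (if b then acc else rej)"
    using assms(2) by (auto simp: halts_def)
  moreover from this have "fst ((nxt ^^ (s + m)) c) = (if b then acc else rej)"
    using assms(1) by (simp add: funpow_add)
  ultimately show ?thesis
    using assms(3) unfolding halts_def by (metis add.commute add_le_mono1 le_trans)
qed

lemma halts_accI: "fst c = acc \<Longrightarrow> b \<Longrightarrow> halts c t b"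
  unfolding halts_def by (rule exI[of _ 0]) simp

lemma halts_rejI: "fst c = rej \<Longrightarrow> \<not> b \<Longrightarrow> halts c t b"
  unfolding halts_def by (rule exI[of _ 0]) simp

text \<open>A verdict in time on every input is all that membership in \<open>class_P\<close> takes;
  which words are accepted is determined separately, through \<open>halts_language\<close>.\<close>

lemma language_in_P:
  fixes p :: "nat poly"
  assumes "\<And>w. \<exists>b. halts (initial w) (poly p (length w)) b"
  shows "language \<in> class_P"
proof -
  obtain g :: "'v sym \<Rightarrow> nat" and ng where g: "g ` UNIV = {..<ng}" "inj g"
    using finite_imp_inj_to_nat_seg[of "UNIV :: 'v sym set"]
    by (auto simp: lessThan_def)
  obtain h :: "'q \<Rightarrow> nat" and nh where h: "h ` UNIV = {..<nh}" "inj h"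
    using finite_imp_inj_to_nat_seg[of "UNIV :: 'q set"]
    by (auto simp: lessThan_def)
  \<comment> \<open>The codes of the blank and of the bits are prescribed by
    \<open>input_tape\<close>; the offset 3 keeps all other symbols clear of them.\<close>
  define e where "e x = (case x of Blank \<Rightarrow> 0 | Bit b \<Rightarrow> bit_symbol b | _ \<Rightarrow> 3 + g x)" for x :: "'v sym"
  have e_inj: "inj e"
    by (rule injI)
      (auto simp: e_def bit_symbol_def dest: injD[OF g(2)] split: sym.splits if_splits)
  have "g x < ng" for x using g(1) by blast
  then have e_less: "e x < 3 + ng" for x
    by (auto simp: e_def bit_symbol_def split: sym.split)
  have h_less: "h q < nh" for q using h(1) by blast
  \<comment> \<open>Numbers outside the range of \<open>e\<close> or \<open>h\<close> decode to
    something arbitrary. \<open>wf_tm\<close> quantifies over such symbols too, and the resulting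
    action is still within range.\<close>
  define tr where "tr q ss = (let r = \<delta> (inv h q) (map (inv e) ss)
    in (h (fst r), map (\<lambda>(x, d). (e x, d)) (snd r)))" for q ss
  define M where "M = \<lparr>tapes = k, symbols = 3 + ng, states = nh,
    start = h q0, accept = h acc, reject = h rej, trans = tr\<rparr>"
  have wf: "wf_tm M"
    using k_pos h_less acc_neq_rej e_less injD[OF h(2)]
    by (auto simp: wf_tm_def M_def tr_def Let_def length_actions)
  \<comment> \<open>Lock-step simulation: one step of \<open>nxt\<close> is matched by one step of
    \<open>M\<close>, so the time bound carries over unchanged.\<close>
  define R where "R c c' \<longleftrightarrow> fst c' = h (fst c) \<and> length (snd c) = k \<and>
    list_all2 (represents e) (snd c) (snd c')" for c c'
  have R_step: "R (nxt c) (step M c')" if "R c c'" for c c'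
  proof (cases "fst c = acc \<or> fst c = rej")
    case True
    then show ?thesis using that by (auto simp: nxt_def step_def R_def M_def)
  next
    case False
    have not_halted: "\<not> (fst c' = accept M \<or> fst c' = reject M)"
      using False that injD[OF h(2)] by (auto simp: R_def M_def)
    have rep: "list_all2 (represents e) (snd c) (snd c')" and len: "length (snd c) = k"
      using that by (auto simp: R_def)
    have len': "length (snd c') = k"
      using list_all2_lengthD[OF rep] len by simp
    let ?ss = "map (hdb \<circ> snd) (snd c)"
    have "map scan (snd c') = map e ?ss"
      using rep len len'
      by (auto simp: list_all2_conv_all_nth represents_scan intro!: nth_equalityI)
    then have tr: "trans M (fst c') (map scan (snd c')) =
        (h (fst (\<delta> (fst c) ?ss)), map (\<lambda>(x, d). (e x, d)) (snd (\<delta> (fst c) ?ss)))"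
      using that e_inj h(2) by (simp add: M_def tr_def R_def Let_def comp_def inv_f_f)
    have "list_all2 (represents e) (map2 zact as (snd c))
        (map2 act (map (\<lambda>(x, d). (e x, d)) as) (snd c'))" if "length as = k" for as
      using rep that len len'
      by (auto simp: list_all2_conv_all_nth split_beta
          intro!: represents_act[where x = "fst a" and d = "snd a" for a, simplified])
    then show ?thesis
      using False not_halted tr length_actions[of ?ss] len
      by (auto simp: nxt_def step_def R_def Let_def)
  qed
  have R_steps: "R ((nxt ^^ t) c) ((step M ^^ t) c')" if "R c c'" for c c' t
    by (induction t) (auto simp: that intro: R_step)
  have R_initial: "R (initial w) (init_config M w)" for w
    using k_pos
    by (auto simp: R_def initial_def init_config_def M_def represents_def input_tape_def
        blank_tape_def nthb_def e_def nth_map nat_less_iff list_all2_conv_all_nth less_Suc_eq_0_disj nth_Cons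
        split: nat.split)
  have "decides_in_time M language (poly p)"
    unfolding decides_in_time_def
  proof
    fix w
    obtain b where b: "halts (initial w) (poly p (length w)) b" using assms by blast
    then obtain t where t: "t \<le> poly p (length w)"
      "fst ((nxt ^^ t) (initial w)) = (if b then acc else rej)"
      by (auto simp: halts_def)
    have "fst ((step M ^^ t) (init_config M w)) = (if b then accept M else reject M)"
      using R_steps[OF R_initial, of t w] t(2) by (auto simp: R_def M_def)
    then show "\<exists>t\<le>poly p (length w). fst ((step M ^^ t) (init_config M w)) =
        (if w \<in> language then accept M else reject M)"
      using t(1) halts_language[OF b] by auto
  qed
  then show ?thesis using wf by (auto simp: class_P_def)
qed

end

section \<open>The verifier\<close>

datatype track = X1 | X2 | X3 | Y

instance track :: finite
proof (intro_classes, rule finite_UNIV_cover)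
  show "finite ({X1, X2, X3, Y})"
    by simp
  show "x \<in> {X1, X2, X3, Y}" for x :: "track"
    by (cases x) auto
qed

text \<open>One cell carries the bits of all parallel evaluations: \<open>X1\<close> and
  \<open>X2\<close> belong to the two candidates, \<open>X3\<close> to the rival x', and
  \<open>Y\<close> to the y that all of them share.\<close>

type_synonym val = "track \<Rightarrow> bool"

text \<open>The flag is the last bit of the code of a binary connective or gate, so both operators
  share one rule.\<close>

definition comb :: "bool \<Rightarrow> val \<Rightarrow> val \<Rightarrow> val" where
  "comb d v v' = (\<lambda>t. if d then v t \<or> v' t else v t \<and> v' t)"

text \<open>A unary number is read while walking along the table. Running off the table yields
  \<open>None\<close>, so the look-up doubles as the range check for variables and wires.\<close>

fun seek :: "val list \<Rightarrow> bool list \<Rightarrow> (val \<times> bool list) option" where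
  "seek (v # A) (True # ws) = seek A ws"
| "seek (v # A) (False # ws) = Some (v, ws)"
| "seek [] ws = None"
| "seek (v # A) [] = None"

lemma seek_length: "seek A ws = Some (v, ws') \<Longrightarrow> length ws' < length ws"
  by (induction A ws rule: seek.induct) auto

text \<open>A stack evaluator for postfix notation. Every syntax error yields \<open>False\<close>,
  and the two candidates must both satisfy the formula.\<close>

function (sequential) run_sat :: "val list \<Rightarrow> bool list \<Rightarrow> val list \<Rightarrow> bool" where
  "run_sat A [] st = (case st of [v] \<Rightarrow> v X1 \<and> v X2 | _ \<Rightarrow> False)"
| "run_sat A (False # False # False # ws) st =
    (case seek A ws of None \<Rightarrow> False | Some (v, ws') \<Rightarrow> run_sat A ws' (v # st))"
| "run_sat A (False # True # b # ws) st = run_sat A ws ((\<lambda>_. b) # st)"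
| "run_sat A (True # False # False # ws) st =
    (case st of [] \<Rightarrow> False | v # st' \<Rightarrow> run_sat A ws ((\<lambda>t. \<not> v t) # st'))"
| "run_sat A (True # True # d # ws) st =
    (case st of v # v' # st' \<Rightarrow> run_sat A ws (comb d v' v # st') | _ \<Rightarrow> False)"
| "run_sat A _ st = False"
  by pat_completeness auto
termination
  by (relation "measure (\<lambda>(A, ws, st). length ws)") (auto dest: seek_length)

text \<open>Comparison from the most significant bit on: \<open>c t\<close> records that track
  \<open>t\<close> is already strictly ahead of \<open>X3\<close>, after which further bits are
  irrelevant; otherwise \<open>X3\<close> must not get ahead.\<close>

function (sequential) run_outs :: "val list \<Rightarrow> bool list \<Rightarrow> nat \<Rightarrow> val \<Rightarrow> bool" where
  "run_outs A [] n c \<longleftrightarrow> n = 0"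
| "run_outs A (b # ws) n c \<longleftrightarrow>
    (case seek A (b # ws) of None \<Rightarrow> False
     | Some (v, ws') \<Rightarrow> 0 < n \<and> (\<forall>t \<in> {X1, X2}. c t \<or> \<not> v X3 \<or> v t) \<and>
         run_outs A ws' (n - 1) (\<lambda>t. c t \<or> v t \<and> \<not> v X3))"
  by pat_completeness auto
termination
  by (relation "measure (\<lambda>(A, ws, _). length ws)") (auto dest: seek_length)

text \<open>Appending at the end makes the position of a value in the table equal to its wire
  number.\<close>

function (sequential) run_gates :: "val list \<Rightarrow> bool list \<Rightarrow> nat \<Rightarrow> bool" where
  "run_gates A (False # ws) n = run_outs A ws n (\<lambda>_. False)"
| "run_gates A (True # False # False # b # ws) n = run_gates (A @ [\<lambda>_. b]) ws n"
| "run_gates A (True # False # True # ws) n =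
    (case seek A ws of None \<Rightarrow> False
     | Some (v, ws') \<Rightarrow> run_gates (A @ [\<lambda>t. \<not> v t]) ws' n)"
| "run_gates A (True # True # d # ws) n =
    (case seek A ws of None \<Rightarrow> False
     | Some (v, ws') \<Rightarrow> (case seek A ws' of None \<Rightarrow> False
         | Some (v', ws'') \<Rightarrow> run_gates (A @ [comb d v v']) ws'' n))"
| "run_gates A _ n = False"
  by pat_completeness auto
termination
  by (relation "measure (\<lambda>(A, ws, _). length ws)") (auto dest!: seek_length)

text \<open>The \<open>Y\<close> component of the first \<open>n\<close> wires is junk; it is evaluated along, but never inspected.\<close>

definition wires :: "nat \<Rightarrow> val list \<Rightarrow> val list" where
  "wires n qs = take n qs @ map (\<lambda>q _. q Y) (take n qs)"

text \<open>Certificates interleave two words, so that a machine reading from left to right can put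
  bits with the same index into the same cell.\<close>

fun pairs :: "bool list \<Rightarrow> (bool \<times> bool) list" where
  "pairs (a # b # u) = (a, b) # pairs u"
| "pairs _ = []"

definition uvals :: "bool list \<Rightarrow> val list" where
  "uvals u = map (\<lambda>(a, b). (\<lambda>_. False)(X1 := a, X2 := b)) (pairs u)"

definition merge :: "val list \<Rightarrow> bool list \<Rightarrow> val list" where
  "merge qs v = map2 (\<lambda>q (a, b). q(X3 := a, Y := b)) qs (pairs v)"

lemma uvals_simps [simp]:
  "uvals [] = []" "uvals (a # b # u) = (\<lambda>_. False)(X1 := a, X2 := b) # uvals u"
  by (simp_all add: uvals_def)

lemma merge_simps [simp]:
  "merge [] v = []" "merge (q # qs) (a # b # v) = q(X3 := a, Y := b) # merge qs v"
  by (simp_all add: merge_def)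

lemma length_uvals: "even (length u) \<Longrightarrow> 2 * length (uvals u) = length u"
  by (induction u rule: pairs.induct) auto

lemma length_merge: "length v = 2 * length qs \<Longrightarrow> length (merge qs v) = length qs"
proof (induction v arbitrary: qs rule: pairs.induct)
  case (1 a b v)
  then show ?case by (cases qs) auto
next
  case ("2_2" x)
  then have "Suc 0 = 2 * length qs" by simp
  then have False by presburger
  then show ?case ..
qed simp

lemma unary_cases:
  obtains n where "w = replicate n True" | n ws where "w = unary n @ ws"
proof (induction w arbitrary: thesis)
  case Nil
  then show ?case by (metis replicate_0)
next
  case (Cons b w)
  show ?case
  proof (cases b)
    case False
    then show ?thesis using Cons.prems(2)[of 0 w] by (simp add: unary_def)
  next
    case True
    show ?thesis
    proof (rule Cons.IH)
      show ?thesis if "w = replicate n True" for n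
        using Cons.prems(1)[of "Suc n"] True that by simp
      show ?thesis if "w = unary n @ ws" for n ws
        using Cons.prems(2)[of "Suc n" ws] True that by (simp add: unary_def)
    qed
  qed
qed

section \<open>Control states and transitions\<close>

datatype reader = ReadW | ReadU "bool option" | ReadV "bool option"

text \<open>A look-up is a subroutine: the control remembers what to do with the value found,
  including the operand fetched before (\<open>ToSnd\<close>) and the state of the comparison
  (\<open>ToOut\<close>).\<close>

datatype dest = ToPush | ToNot | ToFst bool | ToSnd bool val | ToOut val

text \<open>The states that can be entered after a rewind; \<open>Rew\<close> and
  \<open>RewA\<close> carry them as return addresses.\<close>

datatype goal = Read reader | CopyX bool | CopyY | Tok | Seek dest | Gate | Out val

datatype state =
    Acc | Rej | Init
  | Go goal | Rew goal | RewA goal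
  | Read2 reader bool
  | Tok1 bool | Tok2 bool bool | SNeg | SOp1 bool | SOp2 bool val | Fin1 | Fin2
  | Gate1 | Gate2 bool | Gate3
  | Do dest val | App val

instance reader :: finite
proof (intro_classes, rule finite_UNIV_cover)
  show "finite ({ReadW} \<union> range ReadU \<union> range ReadV)"
    by simp
  show "x \<in> {ReadW} \<union> range ReadU \<union> range ReadV" for x :: "reader"
    by (cases x) auto
qed

instance dest :: finite
proof (intro_classes, rule finite_UNIV_cover)
  show "finite ({ToPush, ToNot} \<union> range ToFst \<union> range (case_prod ToSnd) \<union> range ToOut)"
    by simp
  show "x \<in> {ToPush, ToNot} \<union> range ToFst \<union> range (case_prod ToSnd) \<union> range ToOut" for x :: "dest"
    by (cases x) auto
qed

instance goal :: finite
proof (intro_classes, rule finite_UNIV_cover)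
  show "finite ({CopyY, Tok, Gate} \<union> range Read \<union> range CopyX \<union> range Seek \<union> range Out)"
    by simp
  show "x \<in> {CopyY, Tok, Gate} \<union> range Read \<union> range CopyX \<union> range Seek \<union> range Out" for x :: "goal"
    by (cases x) auto
qed

instance state :: finite
proof (intro_classes, rule finite_UNIV_cover)
  show "finite ({Acc, Rej, Init, SNeg, Fin1, Fin2, Gate1, Gate3} \<union> range Go \<union> range Rew \<union> range RewA \<union>
      range (case_prod Read2) \<union> range Tok1 \<union> range (case_prod Tok2) \<union> range SOp1 \<union>
      range (case_prod SOp2) \<union> range Gate2 \<union> range (case_prod Do) \<union> range App)"
    by simp
  show "x \<in> {Acc, Rej, Init, SNeg, Fin1, Fin2, Gate1, Gate3} \<union> range Go \<union> range Rew \<union> range RewA \<union>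
      range (case_prod Read2) \<union> range Tok1 \<union> range (case_prod Tok2) \<union> range SOp1 \<union>
      range (case_prod SOp2) \<union> range Gate2 \<union> range (case_prod Do) \<union> range App" for x :: "state"
    by (cases x) auto
qed

type_synonym action = "val sym \<times> move"

abbreviation K :: "val sym \<Rightarrow> action" where "K x \<equiv> (x, Stay)"
abbreviation L :: "val sym \<Rightarrow> action" where "L x \<equiv> (x, MoveLeft)"
abbreviation R :: "val sym \<Rightarrow> action" where "R x \<equiv> (x, MoveRight)"

text \<open>
  The five tapes: the input; the word \<open>w\<close> of the tuple \<open>[w, u, v]\<close>; the bits of \<open>u\<close> and \<open>v\<close>
  grouped into values \<open>(x1, x2, x3, y)\<close>; the values of the variables or wires; the stack for
  formulas. All tapes but the input start with a mark, so that their heads can be rewound. After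
  \<open>CopyY\<close> the head of the third tape has advanced by the number \<open>n\<close> given in \<open>w\<close>; it then serves as
  a counter for the outputs of the circuit.
\<close>

locale verifier =
  fixes sat differ :: bool
begin

text \<open>In \<open>Read2\<close>, two unequal bits ending in 1 form the terminator 01, whereas 10
  and a premature blank are rejected. The third tape must be exhausted when \<open>v\<close> ends,
  since both certificates have the same number of pairs. Popped stack values may remain to the right
  of the head as garbage until they are overwritten.\<close>

fun tr :: "state \<Rightarrow> val sym \<Rightarrow> val sym \<Rightarrow> val sym \<Rightarrow> val sym \<Rightarrow> val sym \<Rightarrow> state \<times> action \<times> action \<times> action \<times> action \<times> action" where
  "tr Acc i w u a s = (Acc, K i, K w, K u, K a, K s)"
| "tr Rej i w u a s = (Rej, K i, K w, K u, K a, K s)"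
| "tr Init i w u a s = (Go (Read ReadW), K i, R Mark, R Mark, R Mark, R Mark)"
| "tr (Go (Read k)) i w u a s =
    (case i of Bit b \<Rightarrow> (Read2 k b, R i, K w, K u, K a, K s)
     | _ \<Rightarrow> (Rej, K i, K w, K u, K a, K s))"
| "tr (Read2 k b) i w u a s =
    (if i = Bit b then
       (case k of
          ReadW \<Rightarrow> (Go (Read ReadW), R i, R (Bit b), K u, K a, K s)
        | ReadU None \<Rightarrow> (Go (Read (ReadU (Some b))), R i, K w, K u, K a, K s)
        | ReadU (Some c) \<Rightarrow>
            (Go (Read (ReadU None)),
             R i, K w, R (Val ((\<lambda>_. False)(X1 := c, X2 := b))), K a, K s)
        | ReadV None \<Rightarrow> (Go (Read (ReadV (Some b))), R i, K w, K u, K a, K s)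
        | ReadV (Some c) \<Rightarrow>
            (case u of Val q \<Rightarrow>
               (Go (Read (ReadV None)), R i, K w, R (Val (q(X3 := c, Y := b))), K a, K s)
             | _ \<Rightarrow> (Rej, K i, K w, K u, K a, K s)))
     else if i = Bit True then
       (case k of
          ReadW \<Rightarrow> (Go (Read (ReadU None)), R i, K w, K u, K a, K s)
        | ReadU None \<Rightarrow> (Rew (Read (ReadV None)), R i, K w, K u, K a, K s)
        | ReadV None \<Rightarrow>
            (if u = Blank then Rew (CopyX False) else Rej, R i, K w, K u, K a, K s)
        | _ \<Rightarrow> (Rej, K i, K w, K u, K a, K s))
     else (Rej, K i, K w, K u, K a, K s))"
| "tr (Rew g) i w u a s =
    (if w = Mark \<and> u = Mark then (Go g, K i, R w, R u, K a, K s)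
     else (Rew g, K i, if w = Mark then K w else L w, if u = Mark then K u else L u, K a, K s))"
| "tr (RewA g) i w u a s =
    (if a = Mark then (Go g, K i, K w, K u, R a, K s)
     else (RewA g, K i, K w, K u, L a, K s))"
| "tr (Go (CopyX d)) i w u a s =
    (case w of
       Bit True \<Rightarrow>
         (case u of Val q \<Rightarrow> (Go (CopyX (d \<or> q X1 \<noteq> q X2)), K i, R w, R u, R u, K s)
          | _ \<Rightarrow> (Rej, K i, K w, K u, K a, K s))
     | Bit False \<Rightarrow> (if differ \<and> \<not> d then Rej else Rew CopyY, K i, K w, K u, K a, K s)
     | _ \<Rightarrow> (Rej, K i, K w, K u, K a, K s))"
| "tr (Go CopyY) i w u a s =
    (case w of
       Bit True \<Rightarrow>
         (case u of Val q \<Rightarrow> (Go CopyY, K i, R w, R u, R (Val (\<lambda>_. q Y)), K s)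
          | _ \<Rightarrow> (Rej, K i, K w, K u, K a, K s))
     | Bit False \<Rightarrow> (RewA (if sat then Tok else Gate), K i, R w, L u, K a, K s)
     | _ \<Rightarrow> (Rej, K i, K w, K u, K a, K s))"
| "tr (Go (Seek d)) i w u a s =
    (case a of
       Val v \<Rightarrow>
         (case w of
            Bit b \<Rightarrow> if b then (Go (Seek d), K i, R w, K u, R a, K s)
              else (Do d v, K i, R w, K u, K a, K s)
          | _ \<Rightarrow> (Rej, K i, K w, K u, K a, K s))
     | _ \<Rightarrow> (Rej, K i, K w, K u, K a, K s))"
| "tr (Do d v) i w u a s =
    (case d of
       ToPush \<Rightarrow> (RewA Tok, K i, K w, K u, K a, R (Val v))
     | ToNot \<Rightarrow> (App (\<lambda>t. \<not> v t), K i, K w, K u, K a, K s)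
     | ToFst c \<Rightarrow> (RewA (Seek (ToSnd c v)), K i, K w, K u, K a, K s)
     | ToSnd c v' \<Rightarrow> (App (comb c v' v), K i, K w, K u, K a, K s)
     | ToOut c \<Rightarrow>
         (if u \<noteq> Mark \<and> (\<forall>t \<in> {X1, X2}. c t \<or> \<not> v X3 \<or> v t)
          then (RewA (Out (\<lambda>t. c t \<or> v t \<and> \<not> v X3)), K i, K w, L u, K a, K s)
          else (Rej, K i, K w, K u, K a, K s)))"
| "tr (App v) i w u a s =
    (if a = Blank then (RewA Gate, K i, K w, K u, K (Val v), K s)
     else (App v, K i, K w, K u, R a, K s))"
| "tr (Go Tok) i w u a s =
    (case w of Bit b \<Rightarrow> (Tok1 b, K i, R w, K u, K a, K s)
     | _ \<Rightarrow> (Fin1, K i, K w, K u, K a, L s))"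
| "tr (Tok1 b) i w u a s =
    (case w of Bit c \<Rightarrow> (Tok2 b c, K i, R w, K u, K a, K s)
     | _ \<Rightarrow> (Rej, K i, K w, K u, K a, K s))"
| "tr (Tok2 b c) i w u a s =
    (case w of
       Bit d \<Rightarrow>
         (if b \<and> c then (SOp1 d, K i, R w, K u, K a, L s)
          else if b \<and> \<not> d then (SNeg, K i, R w, K u, K a, L s)
          else if \<not> b \<and> c then (Go Tok, K i, R w, K u, K a, R (Val (\<lambda>_. d)))
          else if \<not> b \<and> \<not> d then (Go (Seek ToPush), K i, R w, K u, K a, K s)
          else (Rej, K i, K w, K u, K a, K s))
     | _ \<Rightarrow> (Rej, K i, K w, K u, K a, K s))"
| "tr SNeg i w u a s =
    (case s of Val v \<Rightarrow> (Go Tok, K i, K w, K u, K a, R (Val (\<lambda>t. \<not> v t)))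
     | _ \<Rightarrow> (Rej, K i, K w, K u, K a, K s))"
| "tr (SOp1 d) i w u a s =
    (case s of Val v \<Rightarrow> (SOp2 d v, K i, K w, K u, K a, L s)
     | _ \<Rightarrow> (Rej, K i, K w, K u, K a, K s))"
| "tr (SOp2 d v) i w u a s =
    (case s of Val v' \<Rightarrow> (Go Tok, K i, K w, K u, K a, R (Val (comb d v' v)))
     | _ \<Rightarrow> (Rej, K i, K w, K u, K a, K s))"
| "tr Fin1 i w u a s =
    (case s of Val v \<Rightarrow> (if v X1 \<and> v X2 then Fin2 else Rej, K i, K w, K u, K a, L s)
     | _ \<Rightarrow> (Rej, K i, K w, K u, K a, K s))"
| "tr Fin2 i w u a s = (if s = Mark then Acc else Rej, K i, K w, K u, K a, K s)"
| "tr (Go Gate) i w u a s =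
    (case w of Bit b \<Rightarrow> (if b then Gate1 else Go (Out (\<lambda>_. False)), K i, R w, K u, K a, K s)
     | _ \<Rightarrow> (Rej, K i, K w, K u, K a, K s))"
| "tr Gate1 i w u a s =
    (case w of Bit b \<Rightarrow> (Gate2 b, K i, R w, K u, K a, K s)
     | _ \<Rightarrow> (Rej, K i, K w, K u, K a, K s))"
| "tr (Gate2 b) i w u a s =
    (case w of
       Bit c \<Rightarrow> (if b then Go (Seek (ToFst c)) else if c then Go (Seek ToNot) else Gate3,
         K i, R w, K u, K a, K s)
     | _ \<Rightarrow> (Rej, K i, K w, K u, K a, K s))"
| "tr Gate3 i w u a s =
    (case w of Bit b \<Rightarrow> (App (\<lambda>_. b), K i, R w, K u, K a, K s)
     | _ \<Rightarrow> (Rej, K i, K w, K u, K a, K s))"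
| "tr (Go (Out c)) i w u a s =
    (if w = Blank then (if u = Mark then Acc else Rej, K i, K w, K u, K a, K s)
     else (Go (Seek (ToOut c)), K i, K w, K u, K a, K s))"

definition tr_list :: "state \<Rightarrow> val sym list \<Rightarrow> state \<times> action list" where
  "tr_list q ss = (case ss of
     [i, w, u, a, s] \<Rightarrow> (case tr q i w u a s of (q', ai, aw, au, aa, as) \<Rightarrow> (q', [ai, aw, au, aa, as]))
   | _ \<Rightarrow> (q, map K ss))"

sublocale machine tr_list 5 Init Acc Rej
  by unfold_locales (auto simp: tr_list_def split: list.split prod.split)

lemma nxt_conf [simp]:
  assumes "q \<noteq> Acc" "q \<noteq> Rej"
  shows "nxt (q, [zi, zw, zu, za, zs]) =
    (case tr q (hdb (snd zi)) (hdb (snd zw)) (hdb (snd zu)) (hdb (snd za)) (hdb (snd zs))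
     of (q', ai, aw, au, aa, as) \<Rightarrow>
       (q', [zact ai zi, zact aw zw, zact au zu, zact aa za, zact as zs]))"
  using assms by (simp add: nxt_def tr_list_def split: prod.split)

section \<open>Rewinding, look-up and evaluation on tape\<close>

definition loaded :: "val sym list \<Rightarrow> val ztape \<Rightarrow> bool" where
  "loaded c z \<longleftrightarrow> rev (fst z) @ snd z = Mark # c \<and> Mark \<notin> set c \<and> Blank \<notin> set c"

lemma loaded_home: "loaded c ([], r) \<Longrightarrow> r = Mark # c"
  by (simp add: loaded_def)

text \<open>Off the home cell no mark is scanned, so a rewinding head keeps moving; and the cell it
  enters is not blank, so \<open>bcons\<close> does not drop it.\<close>

lemma loaded_left:
  assumes "loaded c (x # l, r)"
  shows "hdb r \<noteq> Mark" "x \<noteq> Blank" "loaded c (l, x # r)"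
proof -
  have eq: "rev l @ x # r = Mark # c" and c: "Mark \<notin> set c" "Blank \<notin> set c"
    using assms by (auto simp: loaded_def)
  show "loaded c (l, x # r)" using eq c by (simp add: loaded_def)
  have "set r \<subseteq> set c" "x = Mark \<or> x \<in> set c"
    using eq by (cases "rev l"; auto)+
  then show "hdb r \<noteq> Mark" "x \<noteq> Blank"
    using c by (cases r; auto)+
qed

lemma loaded_map_Val: "loaded (map Val A) (l, r) \<longleftrightarrow> rev l @ r = Mark # map Val A"
  by (auto simp: loaded_def)

lemma bcons_not_Blank: "x \<noteq> Blank \<Longrightarrow> bcons x r = x # r"
  by (simp add: bcons_def)

text \<open>Both heads move at once and the first to arrive waits on its mark, so the longer
  distance bounds the time; the extra step leaves the marks.\<close>

lemma halts_rew:
  assumes "loaded cw (lw, rw)" "loaded cu (lu, ru)" "length lw \<le> n" "length lu \<le> n"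
    and "halts (Go g, [zi, ([Mark], cw), ([Mark], cu), za, zs]) t b"
  shows "halts (Rew g, [zi, (lw, rw), (lu, ru), za, zs]) (n + 1 + t) b"
  using assms(1-4)
proof (induction n arbitrary: lw rw lu ru)
  case 0
  then have "lw = []" "lu = []" "rw = Mark # cw" "ru = Mark # cu"
    by (auto dest: loaded_home)
  then show ?case
    by (intro halts_steps[where m = 1, OF _ assms(5)]) simp_all
next
  case (Suc n)
  show ?case
  proof (cases lw)
    case Nil
    then have w: "rw = Mark # cw" using Suc.prems(1) loaded_home by blast
    show ?thesis
    proof (cases lu)
      case Nil
      then have "ru = Mark # cu" using Suc.prems(2) loaded_home by blast
      then show ?thesis using w Nil \<open>lw = []\<close>
        by (intro halts_steps[where m = 1, OF _ assms(5)]) simp_all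
    next
      case (Cons y l)
      note u = loaded_left[OF Suc.prems(2)[unfolded Cons]]
      have "halts (Rew g, [zi, (lw, rw), (l, y # ru), za, zs]) (n + 1 + t) b"
        using Suc.prems u Cons Nil by (intro Suc.IH) auto
      from halts_steps[where m = 1, OF _ this] show ?thesis
        using u Cons Nil w by (simp add: bcons_not_Blank)
    qed
  next
    case Cons1: (Cons x l')
    note w = loaded_left[OF Suc.prems(1)[unfolded Cons1]]
    show ?thesis
    proof (cases lu)
      case Nil
      then have u: "ru = Mark # cu" using Suc.prems(2) loaded_home by blast
      have "halts (Rew g, [zi, (l', x # rw), (lu, ru), za, zs]) (n + 1 + t) b"
        using Suc.prems u w Cons1 Nil by (intro Suc.IH) auto
      from halts_steps[where m = 1, OF _ this] show ?thesis
        using u Cons1 Nil w by (simp add: bcons_not_Blank)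
    next
      case (Cons y l)
      note u = loaded_left[OF Suc.prems(2)[unfolded Cons]]
      have "halts (Rew g, [zi, (l', x # rw), (l, y # ru), za, zs]) (n + 1 + t) b"
        using Suc.prems u w Cons Cons1 by (intro Suc.IH) auto
      from halts_steps[where m = 1, OF _ this] show ?thesis
        using u Cons Cons1 w by (simp add: bcons_not_Blank)
    qed
  qed
qed

lemma halts_rewA:
  assumes "loaded (map Val A) (la, ra)" "length la \<le> n"
    and "halts (Go g, [zi, zw, zu, ([Mark], map Val A), zs]) t b"
  shows "halts (RewA g, [zi, zw, zu, (la, ra), zs]) (n + 1 + t) b"
  using assms(1,2)
proof (induction la arbitrary: ra n)
  case Nil
  then show ?case
    by (intro halts_steps[where m = 1, OF _ assms(3)]) (auto dest: loaded_home)
next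
  case (Cons x la)
  note a = loaded_left[OF Cons.prems(1)]
  have "halts (RewA g, [zi, zw, zu, (la, x # ra), zs]) (n - 1 + 1 + t) b"
    using a Cons.prems by (intro Cons.IH) auto
  from halts_steps[where m = 1, OF _ this] show ?case
    using a Cons.prems(2) by (simp add: bcons_not_Blank)
qed

lemma nxt_final [simp]: "nxt (Acc, zs) = (Acc, zs)" "nxt (Rej, zs) = (Rej, zs)"
  by (simp_all add: nxt_def)

lemma rejI:
  assumes "(nxt ^^ m) c = (Rej, zs)" "\<not> b" "m \<le> t"
  shows "halts c t b"
  using halts_steps[OF assms(1) halts_rejI[of _ b 0]] assms(2,3) by simp

text \<open>The continuation is assumed to work for every head position that leaves the table
  contents unchanged, which is all that a later rewind relies on. A failed look-up rejects and hence
  forces \<open>\<not> b\<close>.\<close>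

lemma halts_seek:
  assumes "\<And>v ws' lw' la' ra'. seek Q ws = Some (v, ws') \<Longrightarrow> rev la' @ ra' = rev la @ map Val Q \<Longrightarrow>
      halts (Do d v, [zi, (lw', map Bit ws'), zu, (la', ra'), zs]) t b"
    and "seek Q ws = None \<Longrightarrow> \<not> b"
  shows "halts (Go (Seek d), [zi, (lw, map Bit ws), zu, (la, map Val Q), zs]) (length Q + 1 + t) b"
  using assms
proof (induction Q ws arbitrary: lw la rule: seek.induct)
  case (1 v A ws)
  have "halts (Go (Seek d), [zi, (Bit True # lw, map Bit ws), zu, (Val v # la, map Val A), zs])
      (length A + 1 + t) b"
    by (rule "1.IH") (use "1.prems" in auto)
  from halts_steps[where m = 1, OF _ this] show ?case by simp
next
  case (2 v A ws)
  have "halts (Do d v, [zi, (Bit False # lw, map Bit ws), zu, (la, map Val (v # A)), zs]) t b"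
    by (rule "2.prems") auto
  from halts_steps[where m = 1, OF _ this] show ?case by simp
next
  case (3 ws)
  then show ?case by (cases ws; intro rejI[where m = 1]) simp_all
next
  case (4 v A)
  then show ?case by (intro rejI[where m = 1]) simp_all
qed

lemma halts_app:
  assumes "halts (RewA Gate, [zi, zw, zu, (rev (map Val Q) @ la, [Val v]), zs]) t b"
  shows "halts (App v, [zi, zw, zu, (la, map Val Q), zs]) (length Q + 1 + t) b"
  using assms
proof (induction Q arbitrary: la)
  case Nil
  then show ?case by (intro halts_steps[where m = 1, OF _ Nil]) simp_all
next
  case (Cons q Q)
  have "halts (App v, [zi, zw, zu, (Val q # la, map Val Q), zs]) (length Q + 1 + t) b"
    using Cons by simp
  from halts_steps[where m = 1, OF _ this] show ?case by simp
qed

text \<open>Each token consumes at least one bit and costs at most one look-up and one rewind, both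
  linear in the table, plus a constant; the \<open>Suc\<close> pays for the final test.
  \<open>rs\<close> is garbage left behind by pops.\<close>

lemma halts_tok:
  "halts (Go Tok, [zi, (lw, map Bit ws), zu, ([Mark], map Val A), (map Val st @ [Mark], rs)])
     (Suc (length ws) * (2 * length A + 10)) (run_sat A ws st)"
proof (induction A ws st arbitrary: lw rs rule: run_sat.induct)
  case (1 A st)
  consider "st = []" | v where "st = [v]" | v v' st' where "st = v # v' # st'"
    by (cases st rule: remdups_adj.cases) auto
  then show ?case
  proof cases
    case 1
    then show ?thesis by (intro rejI[where m = 2]) (simp_all add: eval_nat_numeral)
  next
    case (2 v)
    show ?thesis
    proof (cases "v X1 \<and> v X2")
      case True
      then show ?thesis using 2
        by (intro halts_steps[where m = 3, OF _ halts_accI[of _ _ 0]]) (auto simp: eval_nat_numeral)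
    next
      case False
      then show ?thesis using 2
        by (intro rejI[where m = 2]) (auto simp: eval_nat_numeral)
    qed
  next
    case (3 v v' st')
    then show ?thesis
      by (cases "v X1"; cases "v X2"; intro rejI[where m = 3]) (simp_all add: eval_nat_numeral)
  qed
next
  case (2 A ws st)
  let ?b = "run_sat A (False # False # False # ws) st"
  have "halts (Go (Seek ToPush), [zi, (lw', map Bit ws), zu, ([Mark], map Val A), (map Val st @ [Mark], rs)])
      (length A + 1 + (1 + (length A + 1 + 1 + (Suc (length ws) * (2 * length A + 10))))) ?b" for lw'
  proof (rule halts_seek)
    fix v ws' lw' la' ra'
    assume s: "seek A ws = Some (v, ws')" and a: "rev la' @ ra' = rev [Mark] @ map Val A"
    \<comment> \<open>Since the contents are unchanged, the head is at most just behind the table,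
      which bounds the rewind.\<close>
    have "length la' \<le> length A + 1"
      using arg_cong[OF a, of length] by simp
    moreover have "halts (Go Tok, [zi, (lw', map Bit ws'), zu, ([Mark], map Val A),
        (map Val (v # st) @ [Mark], tl rs)]) (Suc (length ws') * (2 * length A + 10)) ?b"
      using "2.IH"[OF s] s by simp
    ultimately have "halts (RewA Tok, [zi, (lw', map Bit ws'), zu, (la', ra'),
        (map Val (v # st) @ [Mark], tl rs)]) 
        (length A + 1 + 1 + (Suc (length ws') * (2 * length A + 10))) ?b"
      using a by (intro halts_rewA) (auto simp: loaded_map_Val)
    from halts_steps[where m = 1, OF _ this]
    show "halts (Do ToPush v, [zi, (lw', map Bit ws'), zu, (la', ra'), (map Val st @ [Mark], rs)])
        (1 + (length A + 1 + 1 + (Suc (length ws) * (2 * length A + 10)))) ?b"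
      using seek_length[OF s] by simp
  qed simp
  from halts_steps[where m = 3, OF _ this] show ?case
    by (simp add: eval_nat_numeral)
next
  case (3 A b ws st)
  have "halts (Go Tok, [zi, (lw', map Bit ws), zu, ([Mark], map Val A),
      (map Val ((\<lambda>_. b) # st) @ [Mark], rs')]) (Suc (length ws) * (2 * length A + 10))
      (run_sat A (False # True # b # ws) st)" for lw' rs'
    using 3 by simp
  from halts_steps[where m = 3, OF _ this] show ?case by (simp add: eval_nat_numeral)
next
  case (4 A ws st)
  show ?case
  proof (cases st)
    case Nil
    then show ?thesis by (intro rejI[where m = 4]) (simp_all add: eval_nat_numeral)
  next
    case (Cons v st')
    have "halts (Go Tok, [zi, (lw', map Bit ws), zu, ([Mark], map Val A),
        (map Val ((\<lambda>t. \<not> v t) # st') @ [Mark], rs')]) (Suc (length ws) * (2 * length A + 10))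
        (run_sat A (True # False # False # ws) st)" for lw' rs'
      using "4.IH"[OF Cons] Cons by simp
    from halts_steps[where m = 4, OF _ this] show ?thesis using Cons by (simp add: eval_nat_numeral)
  qed
next
  case (5 A d ws st)
  consider "st = []" | v where "st = [v]" | v v' st' where "st = v # v' # st'"
    by (cases st rule: remdups_adj.cases) auto
  then show ?case
  proof cases
    case 1
    then show ?thesis by (intro rejI[where m = 4]) (simp_all add: eval_nat_numeral)
  next
    case 2
    then show ?thesis by (intro rejI[where m = 5]) (simp_all add: eval_nat_numeral)
  next
    case (3 v v' st')
    have "halts (Go Tok, [zi, (lw', map Bit ws), zu, ([Mark], map Val A),
        (map Val (comb d v' v # st') @ [Mark], rs')]) (Suc (length ws) * (2 * length A + 10))
        (run_sat A (True # True # d # ws) st)" for lw' rs'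
      using "5.IH"[of v "v' # st'" v' st'] 3 by simp
    from halts_steps[where m = 5, OF _ this] show ?thesis using 3 by (simp add: eval_nat_numeral)
  qed
qed (rule rejI[where m = 3]; simp add: eval_nat_numeral)+

text \<open>The number of outputs still expected is the distance of the head of the third tape from
  its mark; each output moves that head one cell to the left.\<close>

lemma halts_outs:
  assumes "loaded (map Val qs) (lu, ru)" "length lu = n"
  shows "halts (Go (Out c), [zi, (lw, map Bit ws), (lu, ru), ([Mark], map Val A), zs])
    (Suc (length ws) * (2 * length A + 10)) (run_outs A ws n c)"
  using assms
proof (induction A ws n c arbitrary: lw lu ru rule: run_outs.induct)
  case (1 A n c)
  show ?case
  proof (cases lu)
    case Nil
    then show ?thesis using 1 loaded_home[of "map Val qs" ru]
      by (intro halts_steps[where m = 1, OF _ halts_accI[of _ _ 0]]) auto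
  next
    case (Cons x l)
    then show ?thesis using 1 loaded_left(1)[of _ x l ru]
      by (intro rejI[where m = 1]) auto
  qed
next
  case (2 A b ws n c)
  let ?b = "run_outs A (b # ws) n c"
  have "halts (Go (Seek (ToOut c)), [zi, (lw, map Bit (b # ws)), (lu, ru), ([Mark], map Val A), zs])
      (length A + 1 + (1 + (length A + 1 + 1 + Suc (length ws) * (2 * length A + 10)))) ?b"
  proof (rule halts_seek)
    fix v ws' lw' la' ra'
    assume s: "seek A (b # ws) = Some (v, ws')" and a: "rev la' @ ra' = rev [Mark] @ map Val A"
    have la': "length la' \<le> length A + 1"
      using arg_cong[OF a, of length] by simp
    have len: "length ws' \<le> length ws" using seek_length[OF s] by simp
    show "halts (Do (ToOut c) v, [zi, (lw', map Bit ws'), (lu, ru), (la', ra'), zs])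
        (1 + (length A + 1 + 1 + Suc (length ws) * (2 * length A + 10))) ?b"
    proof (cases "lu = [] \<or> \<not> (\<forall>t \<in> {X1, X2}. c t \<or> \<not> v X3 \<or> v t)")
      \<comment> \<open>Either there are more outputs than expected, or \<open>X3\<close> gets
        strictly ahead of a track that has not yet been decided.\<close>
      case True
      then have "hdb ru = Mark \<or> \<not> (\<forall>t \<in> {X1, X2}. c t \<or> \<not> v X3 \<or> v t)"
        using "2.prems" loaded_home[of "map Val qs" ru] by auto
      then show ?thesis using True s "2.prems"
        by (intro rejI[where m = 1]) auto
    next
      case False
      then obtain x l where lu: "lu = x # l" by (cases lu) auto
      note u = loaded_left[OF "2.prems"(1)[unfolded lu]]
      have "halts (Go (Out (\<lambda>t. c t \<or> v t \<and> \<not> v X3)), [zi, (lw', map Bit ws'), (l, x # ru), ([Mark], map Val A), zs])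
        (Suc (length ws') * (2 * length A + 10)) ?b"
        using "2.IH"[OF s refl u(3), of lw'] "2.prems"(2) False s lu by auto
      then have "halts (RewA (Out (\<lambda>t. c t \<or> v t \<and> \<not> v X3)), [zi, (lw', map Bit ws'), (l, x # ru), (la', ra'), zs])
        (length A + 1 + 1 + Suc (length ws') * (2 * length A + 10)) ?b"
        using a la' by (intro halts_rewA) (auto simp: loaded_map_Val)
      from halts_steps[where m = 1, OF _ this] show ?thesis
        using u lu False len by (simp add: bcons_not_Blank)
    qed
  qed simp
  from halts_steps[where m = 1, OF _ this] show ?case by simp
qed

lemma halts_append:
  assumes "loaded (map Val A) (la, ra)"
    and "halts (Go Gate, [zi, zw, zu, ([Mark], map Val (A @ [v])), zs]) t b"
  shows "halts (App v, [zi, zw, zu, (la, ra), zs]) (2 * length A + 5 + t) b"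
proof -
  \<comment> \<open>\<open>Q\<close> is the part of the table from the head on; if the head is still
    on the mark, one extra step passes it.\<close>
  obtain Q where Q: "ra = map Val Q \<or> (la = [] \<and> ra = Mark # map Val Q)" "length Q \<le> length A"
  proof (cases "rev la")
    case Nil
    then show ?thesis using assms(1) that[of A] by (auto simp: loaded_def)
  next
    case (Cons x l)
    then have "ra = map Val (drop (length l) A)"
      using assms(1) by (auto simp: loaded_def append_eq_conv_conj drop_map)
    then show ?thesis using that[of "drop (length l) A"] by simp
  qed
  have end_tape: "halts (App v, [zi, zw, zu, (la', map Val Q'), zs]) (2 * length A + 4 + t) b"
    if "rev la' @ map Val Q' = Mark # map Val A" "length Q' \<le> length A" for la' Q'
  proof -
    have "length la' + length Q' = length A + 1"
      using arg_cong[OF that(1), of length] by simp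
    moreover have "rev (rev (map Val Q') @ la') @ [Val v] = Mark # map Val (A @ [v])"
      using that(1) by simp
    ultimately have "halts (RewA Gate, [zi, zw, zu, (rev (map Val Q') @ la', [Val v]), zs])
        (length A + 1 + 1 + t) b"
      by (intro halts_rewA[OF _ _ assms(2)]) (auto simp: loaded_def)
    from halts_mono[OF halts_app[OF this]] show ?thesis using that(2) by simp
  qed
  show ?thesis
  proof (cases "ra = map Val Q")
    case True
    then show ?thesis
      using halts_mono[OF end_tape[of la Q]] assms(1) Q(2) by (auto simp: loaded_def)
  next
    case False
    then have "la = []" "ra = Mark # map Val Q" using Q by auto
    moreover from this have "halts (App v, [zi, zw, zu, ([Mark], map Val Q), zs]) (2 * length A + 4 + t) b"
      using assms(1) Q(2) by (intro end_tape) (auto simp: loaded_def)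
    from halts_steps[where m = 1, OF _ this] have
      "halts (App v, [zi, zw, zu, ([], Mark # map Val Q), zs]) (2 * length A + 5 + t) b" by simp
    ultimately show ?thesis by simp
  qed
qed

text \<open>The table grows during the run, so its size is bounded through \<open>N\<close>: a gate
  adds one wire but consumes at least one bit. The most expensive gate takes two look-ups, one
  rewind between them and one append, about five times the table length.\<close>

lemma halts_gates:
  assumes "loaded (map Val qs) (lu, ru)" "length lu = n" "length A + length ws \<le> N"
  shows "halts (Go Gate, [zi, (lw, map Bit ws), (lu, ru), ([Mark], map Val A), zs])
    (Suc (length ws) * (6 * N + 20)) (run_gates A ws n)"
  using assms
proof (induction A ws n arbitrary: lw rule: run_gates.induct)
  case (1 A ws n)
  have *: "Suc (length ws) * (2 * length A + 10) \<le> Suc (length ws) * (6 * N + 20)"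
    using 1 by (intro mult_le_mono) auto
  note halts_outs[OF "1.prems"(1,2), of "\<lambda>_. False" zi "Bit False # lw" ws A zs]
  from halts_steps[where m = 1, OF _ this] * show ?case by simp
next
  case (2 A b ws n)
  have "halts (Go Gate, [zi, (lw', map Bit ws), (lu, ru), ([Mark], map Val (A @ [\<lambda>_. b])), zs])
    (Suc (length ws) * (6 * N + 20)) (run_gates (A @ [\<lambda>_. b]) ws n)" for lw'
    using 2 by simp
  then have "halts (App (\<lambda>_. b), [zi, (lw', map Bit ws), (lu, ru), ([Mark], map Val A), zs])
    (2 * length A + 5 + Suc (length ws) * (6 * N + 20)) (run_gates (A @ [\<lambda>_. b]) ws n)" for lw'
    by (intro halts_append) (auto simp: loaded_def)
  from halts_steps[where m = 4, OF _ this] show ?case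
    using "2.prems" by (simp add: eval_nat_numeral)
next
  case (3 A ws n)
  let ?b = "run_gates A (True # False # True # ws) n"
  have "halts (Go (Seek ToNot), [zi, (lw', map Bit ws), (lu, ru), ([Mark], map Val A), zs])
      (length A + 1 + (1 + (2 * length A + 5 + Suc (length ws) * (6 * N + 20)))) ?b" for lw'
  proof (rule halts_seek)
    fix v ws' lw' la' ra'
    assume s: "seek A ws = Some (v, ws')" and a: "rev la' @ ra' = rev [Mark] @ map Val A"
    have len: "length ws' < length ws" using seek_length[OF s] by simp
    have "halts (App (\<lambda>t. \<not> v t), [zi, (lw', map Bit ws'), (lu, ru), (la', ra'), zs])
        (2 * length A + 5 + Suc (length ws') * (6 * N + 20)) ?b"
      using "3.IH"[OF s refl "3.prems"(1,2), of lw'] "3.prems"(3) s a len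
      by (intro halts_append) (auto simp: loaded_def)
    from halts_steps[where m = 1, OF _ this]
    show "halts (Do ToNot v, [zi, (lw', map Bit ws'), (lu, ru), (la', ra'), zs])
        (1 + (2 * length A + 5 + Suc (length ws) * (6 * N + 20))) ?b"
      using len by simp
  qed simp
  from halts_steps[where m = 3, OF _ this] show ?case
    using "3.prems" by (simp add: eval_nat_numeral)
next
  case (4 A d ws n)
  let ?b = "run_gates A (True # True # d # ws) n"
  let ?T = "2 * length A + 5 + Suc (length ws) * (6 * N + 20)"
  have "halts (Go (Seek (ToFst d)), [zi, (lw', map Bit ws), (lu, ru), ([Mark], map Val A), zs])
      (length A + 1 + (1 + (length A + 1 + 1 + (length A + 1 + (1 + ?T))))) ?b" for lw'
  proof (rule halts_seek)
    fix v ws' lw' la' ra'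
    assume s: "seek A ws = Some (v, ws')" and a: "rev la' @ ra' = rev [Mark] @ map Val A"
    have la': "length la' \<le> length A + 1"
      using arg_cong[OF a, of length] by simp
    have "halts (Go (Seek (ToSnd d v)), [zi, (lw', map Bit ws'), (lu, ru), ([Mark], map Val A), zs])
      (length A + 1 + (1 + ?T)) ?b"
    proof (rule halts_seek)
      fix v' ws'' lw'' la'' ra''
      assume s': "seek A ws' = Some (v', ws'')" and a': "rev la'' @ ra'' = rev [Mark] @ map Val A"
      have len: "length ws'' < length ws" using seek_length[OF s] seek_length[OF s'] by simp
      have "halts (App (comb d v v'), [zi, (lw'', map Bit ws''), (lu, ru), (la'', ra''), zs])
          (2 * length A + 5 + Suc (length ws'') * (6 * N + 20)) ?b"
        using "4.IH"[OF s refl s' refl "4.prems"(1,2), of lw''] "4.prems"(3) s s' a' len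
        by (intro halts_append) (auto simp: loaded_def)
      from halts_steps[where m = 1, OF _ this]
      show "halts (Do (ToSnd d v) v', [zi, (lw'', map Bit ws''), (lu, ru), (la'', ra''), zs])
          (1 + ?T) ?b"
        using len by simp
    qed (simp add: s)
    then have "halts (RewA (Seek (ToSnd d v)), [zi, (lw', map Bit ws'), (lu, ru), (la', ra'), zs])
        (length A + 1 + 1 + (length A + 1 + (1 + ?T))) ?b"
      using a la' by (intro halts_rewA) (auto simp: loaded_map_Val)
    from halts_steps[where m = 1, OF _ this]
    show "halts (Do (ToFst d) v, [zi, (lw', map Bit ws'), (lu, ru), (la', ra'), zs])
        (1 + (length A + 1 + 1 + (length A + 1 + (1 + ?T)))) ?b"
      by simp
  qed simp
  from halts_steps[where m = 3, OF _ this] show ?case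
    using "4.prems" by (simp add: eval_nat_numeral)
qed (rule rejI[where m = 4]; simp add: eval_nat_numeral)+

section \<open>Setting up the table of variables or wires\<close>

lemma halts_copyX:
  assumes "n \<le> length qs"
    and "halts (Go (CopyX (d \<or> (\<exists>q \<in> set (take n qs). q X1 \<noteq> q X2))),
      [zi, (replicate n (Bit True) @ lw, map Bit ws), (rev (map Val (take n qs)) @ lu, map Val (drop n qs)),
       (rev (map Val (take n qs)) @ la, []), zs]) t b"
  shows "halts (Go (CopyX d), [zi, (lw, map Bit (replicate n True @ ws)), (lu, map Val qs), (la, []), zs]) (n + t) b"
  using assms
proof (induction n arbitrary: qs d lw lu la)
  case (Suc n)
  then obtain q qs' where qs: "qs = q # qs'" by (cases qs) auto
  have "halts (Go (CopyX (d \<or> q X1 \<noteq> q X2)), [zi, (Bit True # lw, map Bit (replicate n True @ ws)),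
      (Val q # lu, map Val qs'), (Val q # la, []), zs]) (n + t) b"
    using Suc.prems by (intro Suc.IH) (simp_all add: qs replicate_app_Cons_same disj_assoc)
  from halts_steps[where m = 1, OF _ this] show ?case by (simp add: qs)
qed simp

text \<open>If the unary number exceeds the number of certificate pairs, the third head meets a
  blank before the number ends.\<close>

lemma halts_copyX_short:
  assumes "length qs < n" "\<not> b"
  shows "halts (Go (CopyX d), [zi, (lw, map Bit (replicate n True @ ws)), (lu, map Val qs), (la, []), zs]) n b"
  using assms
proof (induction n arbitrary: qs d lw lu la)
  case (Suc n)
  show ?case
  proof (cases qs)
    case Nil
    then show ?thesis using Suc.prems by (intro rejI[where m = 1]) simp_all
  next
    case (Cons q qs')
    have "halts (Go (CopyX (d \<or> q X1 \<noteq> q X2)), [zi, (Bit True # lw, map Bit (replicate n True @ ws)),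
        (Val q # lu, map Val qs'), (Val q # la, []), zs]) n b"
      using Suc.prems Cons by (intro Suc.IH) simp_all
    from halts_steps[where m = 1, OF _ this] show ?thesis by (simp add: Cons)
  qed
qed simp

lemma halts_copyY:
  assumes "n \<le> length qs"
    and "halts (Go CopyY,
      [zi, (replicate n (Bit True) @ lw, map Bit ws), (rev (map Val (take n qs)) @ lu, map Val (drop n qs)),
       (rev (map (\<lambda>q. Val (\<lambda>_. q Y)) (take n qs)) @ la, []), zs]) t b"
  shows "halts (Go CopyY, [zi, (lw, map Bit (replicate n True @ ws)), (lu, map Val qs), (la, []), zs]) (n + t) b"
  using assms
proof (induction n arbitrary: qs lw lu la)
  case (Suc n)
  then obtain q qs' where qs: "qs = q # qs'" by (cases qs) auto
  have "halts (Go CopyY, [zi, (Bit True # lw, map Bit (replicate n True @ ws)),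
      (Val q # lu, map Val qs'), (Val (\<lambda>_. q Y) # la, []), zs]) (n + t) b"
    using Suc.prems by (intro Suc.IH) (simp_all add: qs replicate_app_Cons_same)
  from halts_steps[where m = 1, OF _ this] show ?case by (simp add: qs)
qed simp

definition run :: "val list \<Rightarrow> bool list \<Rightarrow> nat \<Rightarrow> bool" where
  "run A ws n = (if sat then run_sat A ws [] else run_gates A ws n)"

text \<open>The verdict as a function of the tapes after the tuple has been parsed; it links the
  machine with the interpreters.\<close>

definition check :: "bool list \<Rightarrow> val list \<Rightarrow> bool" where
  "check w qs \<longleftrightarrow> (\<exists>n ws. w = unary n @ ws \<and> n \<le> length qs \<and>
     (differ \<longrightarrow> (\<exists>q \<in> set (take n qs). q X1 \<noteq> q X2)) \<and> run (wires n qs) ws n)"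

lemma check_unary:
  "check (unary n @ ws) qs \<longleftrightarrow> n \<le> length qs \<and>
     (differ \<longrightarrow> (\<exists>q \<in> set (take n qs). q X1 \<noteq> q X2)) \<and> run (wires n qs) ws n"
  by (auto simp: check_def)

lemma not_check_replicate: "\<not> check (replicate n True) qs"
proof
  assume "check (replicate n True) qs"
  then obtain m ws where eq: "replicate n True = unary m @ ws"
    by (auto simp: check_def)
  have "False \<in> set (unary m @ ws)" by (simp add: unary_def)
  then show False by (simp flip: eq split: if_splits)
qed

lemma halts_run:
  assumes "loaded (map Val qs) (lu, ru)" "length lu = n" "length A + length ws \<le> N"
  shows "halts (Go (if sat then Tok else Gate),
      [zi, (lw, map Bit ws), (lu, ru), ([Mark], map Val A), ([Mark], [])])
    (Suc (length ws) * (6 * N + 20)) (run A ws n)"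
proof (cases sat)
  case True
  have *: "Suc (length ws) * (2 * length A + 10) \<le> Suc (length ws) * (6 * N + 20)"
    using assms by (intro mult_le_mono) auto
  show ?thesis
    unfolding run_def if_P[OF True]
    using halts_mono[OF halts_tok[of zi lw ws "(lu, ru)" A "[]" "[]"] *] by simp
next
  case False
  show ?thesis
    unfolding run_def if_not_P[OF False] by (rule halts_gates[OF assms])
qed

text \<open>The table starts with \<open>2 * n\<close> entries and
  \<open>n + length ws \<le> N\<close>, so the bound for the interpreters applies with
  \<open>3 * N\<close>; this gives the coefficient 18. The linear terms pay for copying and
  rewinding.\<close>

lemma halts_check:
  assumes "length w \<le> N" "length qs \<le> N"
  shows "halts (Go (CopyX False), [zi, ([Mark], map Bit w), ([Mark], map Val qs), ([Mark], []), ([Mark], [])])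
    (Suc N * (18 * N + 20) + 10 * N + 20) (check w qs)"
proof (cases w rule: unary_cases)
  case (1 n)
  show ?thesis
  proof (cases "n \<le> length qs")
    case True
    \<comment> \<open>The word ends before the unary number is terminated, so the head scans a blank
      and the machine rejects.\<close>
    have "halts (Go (CopyX (False \<or> (\<exists>q \<in> set (take n qs). q X1 \<noteq> q X2))),
      [zi, (replicate n (Bit True) @ [Mark], map Bit []), (rev (map Val (take n qs)) @ [Mark], map Val (drop n qs)),
       (rev (map Val (take n qs)) @ [Mark], []), ([Mark], [])]) 1 (check w qs)"
      by (intro rejI[where m = 1]) (simp_all add: 1 not_check_replicate)
    from halts_mono[OF halts_copyX[OF True this]] show ?thesis using True assms 1 by simp
  next
    case False
    then show ?thesis
      using halts_mono[OF halts_copyX_short[of qs n "check w qs" False zi "[Mark]" "[]"]] 1 assms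
      by (simp add: not_check_replicate)
  qed
next
  case (2 n ws)
  have w: "w = replicate n True @ False # ws" using 2 by (simp add: unary_def)
  show ?thesis
  proof (cases "n \<le> length qs")
    case False
    then have "\<not> check w qs" by (simp add: 2 check_unary)
    from halts_copyX_short[OF _ this, of qs n] False
    have "halts (Go (CopyX False), [zi, ([Mark], map Bit w), ([Mark], map Val qs), ([Mark], []), ([Mark], [])])
      n (check w qs)"
      by (simp only: w not_le)
    from halts_mono[OF this] show ?thesis using w assms by simp
  next
    case True
    define d where "d \<longleftrightarrow> (\<exists>q \<in> set (take n qs). q X1 \<noteq> q X2)"
    define lu :: "val sym list" where "lu = rev (map Val (take n qs)) @ [Mark]"
    define ru :: "val sym list" where "ru = map Val (drop n qs)"
    define lw :: "val sym list" where "lw = replicate n (Bit True) @ [Mark]"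
    have U: "loaded (map Val qs) (lu, ru)"
      by (simp add: loaded_map_Val lu_def ru_def flip: map_append)
    have W: "loaded (map Bit w) (lw, map Bit (False # ws))"
      by (auto simp: loaded_def lw_def w)
    have len_lu: "length lu = Suc n" using True by (simp add: lu_def)
    \<comment> \<open>After \<open>n\<close> moves the left part of the third tape has length
      \<open>n + 1\<close> because of the mark. Leaving \<open>CopyY\<close> moves the head back by
      one, so that the output counter starts at exactly \<open>n\<close>.\<close>
    then obtain x l where lu: "lu = x # l" "length l = n" by (cases lu) auto
    note u = loaded_left[OF U[unfolded lu]]
    let ?A = "wires n qs"
    let ?Z = "([Mark], [])"
    have len_A: "length ?A = 2 * n" using True by (simp add: wires_def)
    have n: "n + length ws \<le> N" using assms w by simp
    have "halts (Go (if sat then Tok else Gate),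
        [zi, (Bit False # lw, map Bit ws), (l, x # ru), ([Mark], map Val ?A), ?Z])
        (Suc (length ws) * (6 * (3 * N) + 20)) (run ?A ws n)"
      using n by (intro halts_run[OF u(3) lu(2)]) (simp add: len_A)
    then have "halts (RewA (if sat then Tok else Gate),
        [zi, (Bit False # lw, map Bit ws), (l, x # ru), (rev (map Val ?A) @ [Mark], []), ?Z])
        (2 * n + 1 + 1 + Suc (length ws) * (6 * (3 * N) + 20)) (run ?A ws n)"
      by (intro halts_rewA) (simp_all add: len_A loaded_map_Val)
    from halts_steps[where m = 1, OF _ this]
    have "halts (Go CopyY, [zi, (lw, map Bit (False # ws)), (lu, ru), (rev (map Val ?A) @ [Mark], []), ?Z])
        (2 * n + 3 + Suc (length ws) * (6 * (3 * N) + 20)) (run ?A ws n)"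
      by (simp add: lu bcons_not_Blank[OF u(2)])
    then have "halts (Go CopyY, [zi, ([Mark], map Bit w), ([Mark], map Val qs),
        (rev (map Val (take n qs)) @ [Mark], []), ?Z])
        (n + (2 * n + 3 + Suc (length ws) * (6 * (3 * N) + 20))) (run ?A ws n)"
      unfolding w by (intro halts_copyY[OF True]) (simp add: lw_def lu_def ru_def wires_def rev_map comp_def)
    then have *: "halts (Rew CopyY, [zi, (lw, map Bit (False # ws)), (lu, ru),
        (rev (map Val (take n qs)) @ [Mark], []), ?Z])
        (Suc n + 1 + (n + (2 * n + 3 + Suc (length ws) * (6 * (3 * N) + 20)))) (run ?A ws n)"
      using len_lu by (intro halts_rew[OF W U]) (simp_all add: lw_def)
    \<comment> \<open>The difference test takes place at the terminator of the unary number, when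
      \<open>d\<close> has seen precisely the first \<open>n\<close> pairs and none of the
      padding.\<close>
    have "halts (Go (CopyX (False \<or> d)), [zi, (lw, map Bit (False # ws)), (lu, ru),
        (rev (map Val (take n qs)) @ [Mark], []), ?Z])
        (4 * n + 6 + Suc (length ws) * (6 * (3 * N) + 20)) (check w qs)"
    proof (cases "differ \<and> \<not> d")
      case True
      then have "\<not> check w qs" unfolding 2 check_unary d_def by blast
      then show ?thesis by (intro rejI[where m = 1]) (simp_all add: if_P[OF True])
    next
      case False
      then have "check w qs \<longleftrightarrow> run ?A ws n" using True by (auto simp: 2 check_unary d_def)
      then show ?thesis using False halts_steps[where m = 1, OF _ *] by simp
    qed
    note * = halts_copyX[OF True this[unfolded d_def lw_def lu_def ru_def]]
    have "Suc (length ws) * (6 * (3 * N) + 20) \<le> Suc N * (18 * N + 20)"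
      using n by (intro mult_le_mono) auto
    then have "n + (4 * n + 6 + Suc (length ws) * (6 * (3 * N) + 20)) \<le> Suc N * (18 * N + 20) + 10 * N + 20"
      using n by linarith
    from halts_mono[OF * this] show ?thesis by (simp only: w)
  qed
qed

section \<open>Parsing the three components of the input\<close>

definition double :: "bool list \<Rightarrow> bool list" where
  "double bs = concat (map (\<lambda>b. [b, b]) bs)"

lemma double_simps [simp]: "double [] = []" "double (b # bs) = b # b # double bs"
  by (simp_all add: double_def)

lemma length_double [simp]: "length (double bs) = 2 * length bs"
  by (induction bs) auto

text \<open>These are the rests from which neither a doubled bit nor the terminator 01 can be
  read.\<close>

definition malformed :: "bool list \<Rightarrow> bool" where
  "malformed j \<longleftrightarrow> length j \<le> 1 \<or> (\<exists>r. j = True # False # r)"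

lemma input_cases:
  obtains w j where "z = double w @ j" "malformed j" | w r where "z = double w @ False # True # r"
proof (induction z arbitrary: thesis rule: induct_list012)
  case (3 a b z)
  consider "a = b" | "a" "\<not> b" | "\<not> a" "b" by blast
  then show ?case
  proof cases
    case 1
    show ?thesis
    proof (rule "3.IH"(1))
      show ?thesis if "z = double w @ j" "malformed j" for w j
        using "3.prems"(1)[of "a # w" j] that 1 by simp
      show ?thesis if "z = double w @ False # True # r" for w r
        using "3.prems"(2)[of "a # w" r] that 1 by simp
    qed
  next
    case 2
    then show ?thesis using "3.prems"(1)[of "[]" "a # b # z"] by (simp add: malformed_def)
  next
    case 3
    then show ?thesis using "3.prems"(2)[of "[]" z] by simp
  qed
next
  case 1
  then show ?case by (metis append_Nil double_simps(1) le0 list.size(3) malformed_def)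
next
  case (2 a)
  show ?case by (rule 2(1)[of "[]" "[a]"]) (simp_all add: malformed_def)
qed

lemma halts_read_malformed:
  assumes "malformed j" "\<not> b" "2 \<le> t"
  shows "halts (Go (Read k), [(li, map Bit j), zw, zu, za, zs]) t b"
proof -
  consider "j = []" | c where "j = [c]" | r where "j = True # False # r"
    using assms(1) by (cases j rule: remdups_adj.cases) (auto simp: malformed_def)
  then show ?thesis
    using assms(2,3) by cases (intro rejI[where m = 2]; simp add: eval_nat_numeral)+
qed

lemma halts_read_w:
  assumes "\<And>li. halts (Go (Read ReadW), [(li, map Bit j), (rev (map Bit w) @ lw, []), zu, za, zs]) t b"
  shows "halts (Go (Read ReadW), [(li, map Bit (double w @ j)), (lw, []), zu, za, zs]) (2 * length w + t) b"
  using assms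
proof (induction w arbitrary: li lw)
  case (Cons c w)
  have "halts (Go (Read ReadW), [(li', map Bit (double w @ j)), (Bit c # lw, []), zu, za, zs])
      (2 * length w + t) b" for li'
    using Cons by simp
  from halts_steps[where m = 2, OF _ this] show ?case by (simp add: eval_nat_numeral)
qed simp

lemma halts_read_u:
  assumes "even (length u)"
    and "\<And>li. halts (Go (Read (ReadU None)), [(li, map Bit j), zw, (rev (map Val (uvals u)) @ lu, []), za, zs]) t b"
  shows "halts (Go (Read (ReadU None)), [(li, map Bit (double u @ j)), zw, (lu, []), za, zs]) (2 * length u + t) b"
  using assms
proof (induction u arbitrary: li lu rule: pairs.induct)
  case (1 x y u)
  have "halts (Go (Read (ReadU None)), [(li', map Bit (double u @ j)), zw,
      (Val ((\<lambda>_. False)(X1 := x, X2 := y)) # lu, []), za, zs]) (2 * length u + t) b" for li'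
    using 1 by simp
  from halts_steps[where m = 4, OF _ this] show ?case by (simp add: eval_nat_numeral)
qed simp_all

text \<open>The control still holds the first half of a pair when \<open>u\<close> ends, and in that
  state even a proper terminator is rejected.\<close>

lemma halts_read_u_odd:
  assumes "odd (length u)" "malformed j \<or> (\<exists>r. j = False # True # r)" "\<not> b"
  shows "halts (Go (Read (ReadU None)), [(li, map Bit (double u @ j)), zw, (lu, []), za, zs])
    (2 * length u + 2) b"
  using assms
proof (induction u arbitrary: li lu rule: pairs.induct)
  case (1 x y u)
  have "halts (Go (Read (ReadU None)), [(li', map Bit (double u @ j)), zw,
      (Val ((\<lambda>_. False)(X1 := x, X2 := y)) # lu, []), za, zs]) (2 * length u + 2) b" for li'
    using 1 by simp
  from halts_steps[where m = 4, OF _ this] show ?case by (simp add: eval_nat_numeral)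
next
  case ("2_2" x)
  have "halts (Go (Read (ReadU (Some x))), [(li', map Bit j), zw, (lu, []), za, zs]) 2 b" for li'
    using "2_2"(2)
  proof
    assume "\<exists>r. j = False # True # r"
    then show ?thesis using \<open>\<not> b\<close> by (auto intro!: rejI[where m = 2] simp: eval_nat_numeral)
  qed (use halts_read_malformed \<open>\<not> b\<close> in auto)
  from halts_steps[where m = 2, OF _ this] show ?case by (simp add: eval_nat_numeral)
qed simp

lemma halts_read_v:
  assumes "length v = 2 * length qs"
    and "\<And>li. halts (Go (Read (ReadV None)), [(li, map Bit j), zw, (rev (map Val (merge qs v)) @ lu, []), za, zs]) t b"
  shows "halts (Go (Read (ReadV None)), [(li, map Bit (double v @ j)), zw, (lu, map Val qs), za, zs]) (2 * length v + t) b"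
  using assms
proof (induction v arbitrary: li lu qs rule: pairs.induct)
  case (1 x y v)
  then obtain q qs' where qs: "qs = q # qs'" by (cases qs) auto
  have "halts (Go (Read (ReadV None)), [(li', map Bit (double v @ j)), zw,
      (Val (q(X3 := x, Y := y)) # lu, map Val qs'), za, zs]) (2 * length v + t) b" for li'
    using 1 by (simp add: qs)
  from halts_steps[where m = 4, OF _ this] show ?case by (simp add: qs eval_nat_numeral)
next
  case ("2_2" x)
  then have "Suc 0 = 2 * length qs" by simp
  then have False by presburger
  then show ?case ..
qed simp_all

text \<open>If \<open>v\<close> is too long, the third head meets a blank where a value should be
  completed; if it is too short, the terminator arrives while a value is still scanned or half a
  pair is held.\<close>

lemma halts_read_v_mismatch:
  assumes "length v \<noteq> 2 * length qs" "malformed j \<or> (\<exists>r. j = False # True # r)" "\<not> b"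
  shows "halts (Go (Read (ReadV None)), [(li, map Bit (double v @ j)), zw, (lu, map Val qs), za, zs])
    (2 * length v + 2) b"
  using assms
proof (induction v arbitrary: li lu qs rule: pairs.induct)
  case (1 x y v)
  show ?case
  proof (cases qs)
    case Nil
    then show ?thesis using \<open>\<not> b\<close> by (intro rejI[where m = 4]) (simp_all add: eval_nat_numeral)
  next
    case (Cons q qs')
    have "halts (Go (Read (ReadV None)), [(li', map Bit (double v @ j)), zw,
        (Val (q(X3 := x, Y := y)) # lu, map Val qs'), za, zs]) (2 * length v + 2) b" for li'
      using 1 by (simp add: Cons)
    from halts_steps[where m = 4, OF _ this] show ?thesis by (simp add: Cons eval_nat_numeral)
  qed
next
  case "2_1"
  then obtain q qs' where qs: "qs = q # qs'" by (cases qs) auto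
  show ?case using "2_1"(2)
  proof
    assume "\<exists>r. j = False # True # r"
    then show ?thesis using \<open>\<not> b\<close> by (auto intro!: rejI[where m = 2] simp: qs eval_nat_numeral)
  qed (use halts_read_malformed \<open>\<not> b\<close> in auto)
next
  case ("2_2" x)
  have "halts (Go (Read (ReadV (Some x))), [(li', map Bit j), zw, (lu, map Val qs), za, zs]) 2 b" for li'
    using "2_2"(2)
  proof
    assume "\<exists>r. j = False # True # r"
    then show ?thesis using \<open>\<not> b\<close> by (auto intro!: rejI[where m = 2] simp: eval_nat_numeral)
  qed (use halts_read_malformed \<open>\<not> b\<close> in auto)
  from halts_steps[where m = 2, OF _ this] show ?case by (simp add: eval_nat_numeral)
qed

lemma initial_conf: "initial z = (Init, [([], map Bit z), ([], []), ([], []), ([], []), ([], [])])"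
  unfolding initial_def by (simp add: numeral_eq_Suc)

lemma halts_initial_w:
  assumes "\<And>li. halts (Go (Read ReadW),
    [(li, map Bit z), (rev (map Bit w) @ [Mark], []), ([Mark], []), ([Mark], []), ([Mark], [])]) t b"
  shows "halts (initial (double w @ z)) (2 * length w + 1 + t) b"
proof -
  have "halts (Go (Read ReadW), [([], map Bit (double w @ z)),
      ([Mark], []), ([Mark], []), ([Mark], []), ([Mark], [])]) (2 * length w + t) b"
    using assms by (intro halts_read_w) auto
  from halts_steps[where m = 1, OF _ this] show ?thesis
    by (simp add: initial_conf)
qed

lemma halts_part_u:
  assumes "even (length u)"
    and "\<And>li. halts (Go (Read (ReadV None)),
      [(li, map Bit z), ([Mark], map Bit w), ([Mark], map Val (uvals u)), za, zs]) t b"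
  shows "halts (Go (Read (ReadU None)), [(li, map Bit (double u @ False # True # z)),
      (rev (map Bit w) @ [Mark], []), ([Mark], []), za, zs]) (2 * length u + (length w + length u + 4 + t)) b"
proof (rule halts_read_u[OF assms(1)])
  fix li
  have "halts (Rew (Read (ReadV None)), [(Bit True # Bit False # li, map Bit z), (rev (map Bit w) @ [Mark], []),
      (rev (map Val (uvals u)) @ [Mark], []), za, zs]) (length w + length u + 1 + 1 + t) b"
    using length_uvals[OF assms(1)]
    by (intro halts_rew[OF _ _ _ _ assms(2)]) (auto simp: loaded_def)
  from halts_steps[where m = 2, OF _ this]
  show "halts (Go (Read (ReadU None)), [(li, map Bit (False # True # z)), (rev (map Bit w) @ [Mark], []),
      (rev (map Val (uvals u)) @ [Mark], []), za, zs]) (length w + length u + 4 + t) b"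
    by (simp add: eval_nat_numeral)
qed

lemma halts_part_v:
  assumes "length v = 2 * length qs" "length w \<le> N" "length qs \<le> N"
  shows "halts (Go (Read (ReadV None)), [(li, map Bit (double v @ False # True # r)),
      ([Mark], map Bit w), ([Mark], map Val qs), ([Mark], []), ([Mark], [])])
    (2 * length v + (N + 5 + (Suc N * (18 * N + 20) + 10 * N + 20))) (check w (merge qs v))"
proof (rule halts_read_v[OF assms(1)])
  fix li
  note len = length_merge[OF assms(1)]
  have W: "loaded (map Bit w) ([Mark], map Bit w)"
    and U: "loaded (map Val (merge qs v)) (rev (map Val (merge qs v)) @ [Mark], [])"
    by (auto simp: loaded_def)
  have "halts (Rew (CopyX False), [(Bit True # Bit False # li, map Bit r), ([Mark], map Bit w),
      (rev (map Val (merge qs v)) @ [Mark], []), ([Mark], []), ([Mark], [])])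
      (Suc N + 1 + (Suc N * (18 * N + 20) + 10 * N + 20)) (check w (merge qs v))"
    using assms
    by (intro halts_rew[OF W U _ _ halts_check]) (auto simp: len)
  from halts_steps[where m = 2, OF _ this]
  show "halts (Go (Read (ReadV None)), [(li, map Bit (False # True # r)), ([Mark], map Bit w),
      (rev (map Val (merge qs v)) @ [Mark], []), ([Mark], []), ([Mark], [])])
      (N + 5 + (Suc N * (18 * N + 20) + 10 * N + 20)) (check w (merge qs v))"
    by (simp add: eval_nat_numeral)
qed

section \<open>Total running time and the accepted language\<close>

definition time :: "nat poly" where
  "time = smult 100 ([:1, 1:] ^ 2)"

text \<open>Coefficientwise, 18N^2 + 53N + 70 is compared with 100N^2 + 200N + 100. Beyond
  \<open>halts_check\<close>, the left side leaves room for parsing and for the first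
  rewinds.\<close>

lemma time_bound: "Suc N * (18 * N + 20) + 15 * N + 50 \<le> poly time N"
  by (simp add: time_def power2_eq_square algebra_simps)

text \<open>The rest \<open>r\<close> is arbitrary, since the verdict depends on nothing behind the
  third terminator.\<close>

lemma halts_valid:
  assumes "even (length u)" "length v = length u"
    and z: "z = double w @ False # True # double u @ False # True # double v @ False # True # r"
  shows "halts (initial z) (poly time (length z)) (check w (merge (uvals u) v))"
proof -
  let ?b = "check w (merge (uvals u) v)"
  define N where "N = length z"
  have len: "2 * length w + 2 * length u + 2 * length v + 6 \<le> N"
    by (simp add: N_def z)
  have len_u: "2 * length (uvals u) = length u" using length_uvals[OF assms(1)] .
  have "halts (Go (Read (ReadV None)), [(li, map Bit (double v @ False # True # r)),
      ([Mark], map Bit w), ([Mark], map Val (uvals u)), ([Mark], []), ([Mark], [])])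
    (2 * length v + (N + 5 + (Suc N * (18 * N + 20) + 10 * N + 20))) ?b" for li
    using len len_u assms(2) by (intro halts_part_v) auto
  then have u: "halts (Go (Read (ReadU None)), [(li, map Bit (double u @ False # True # double v @ False # True # r)),
      (rev (map Bit w) @ [Mark], []), ([Mark], []), ([Mark], []), ([Mark], [])])
    (2 * length u + (length w + length u + 4 + (2 * length v + (N + 5 + (Suc N * (18 * N + 20) + 10 * N + 20))))) ?b" for li
    by (rule halts_part_u[OF assms(1)])
  have "halts (Go (Read ReadW), [(li, map Bit (False # True # double u @ False # True # double v @ False # True # r)),
      (rev (map Bit w) @ [Mark], []), ([Mark], []), ([Mark], []), ([Mark], [])])
    (2 + (2 * length u + (length w + length u + 4 + (2 * length v + (N + 5 + (Suc N * (18 * N + 20) + 10 * N + 20)))))) ?b" for li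
    by (rule halts_steps[where m = 2, OF _ u]) (simp_all add: eval_nat_numeral)
  note * = halts_initial_w[OF this, folded z]
  show ?thesis
    by (rule halts_mono[OF *]) (use len time_bound[of N] in \<open>simp add: N_def\<close>)
qed

text \<open>Arbitrary strings must be decided in time as well. Splitting off doubled words one after
  the other either exposes a defect, which is rejected, or leads to the situation of
  \<open>halts_valid\<close>.\<close>

lemma halts_any: "\<exists>b. halts (initial z) (poly time (length z)) b"
proof -
  have T: "poly time (length z) \<ge> 15 * length z + 50"
    using time_bound[of "length z"] by simp
  show ?thesis
  proof (cases z rule: input_cases)
    case (1 w j)
    then have "halts (Go (Read ReadW), [(li, map Bit j),
        (rev (map Bit w) @ [Mark], []), ([Mark], []), ([Mark], []), ([Mark], [])]) 2 False" for li
      by (intro halts_read_malformed) auto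
    from halts_mono[OF halts_initial_w[OF this], of "poly time (length z)"] show ?thesis
      using T 1 by auto
  next
    case w: (2 w z1)
    have step_u: ?thesis
      if "\<And>li. halts (Go (Read (ReadU None)), [(li, map Bit z1),
        (rev (map Bit w) @ [Mark], []), ([Mark], []), ([Mark], []), ([Mark], [])]) (10 * length z + 20) False"
    proof -
      have "halts (Go (Read ReadW), [(li, map Bit (False # True # z1)),
          (rev (map Bit w) @ [Mark], []), ([Mark], []), ([Mark], []), ([Mark], [])])
          (2 + (10 * length z + 20)) False" for li
        by (rule halts_steps[where m = 2, OF _ that]) (simp_all add: eval_nat_numeral)
      from halts_mono[OF halts_initial_w[OF this], of "poly time (length z)"] show ?thesis
        using T w by auto
    qed
    show ?thesis
    proof (cases "\<exists>u z2. z1 = double u @ False # True # z2 \<and> even (length u)")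
      case False
      obtain u j where uj: "z1 = double u @ j" "malformed j \<or> (\<exists>r. j = False # True # r)"
        by (cases z1 rule: input_cases) auto
      have *: "halts (Go (Read (ReadU None)), [(li, map Bit z1),
        (rev (map Bit w) @ [Mark], []), ([Mark], []), ([Mark], []), ([Mark], [])]) (2 * length u + 2) False" for li
      proof (cases "even (length u)")
        case True
        then have "malformed j" using False uj by auto
        then show ?thesis unfolding uj(1)
          by (intro halts_read_u[OF True] halts_read_malformed) auto
      next
        case False
        then show ?thesis using halts_read_u_odd[OF False uj(2)] by (simp add: uj(1))
      qed
      have "2 * length u + 2 \<le> 10 * length z + 20" by (simp add: w uj)
      with * show ?thesis by (intro step_u) (rule halts_mono)
    next
      case True
      then obtain u z2 where u: "z1 = double u @ False # True # z2" "even (length u)" by blast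
      have len_u: "2 * length (uvals u) = length u" using length_uvals[OF u(2)] .
      obtain v j where vj: "z2 = double v @ j" "malformed j \<or> (\<exists>r. j = False # True # r)"
        by (cases z2 rule: input_cases) auto
      show ?thesis
      proof (cases "length v = length u \<and> (\<exists>r. j = False # True # r)")
        case True
        then obtain r where "j = False # True # r" "length v = length u" by blast
        then show ?thesis using halts_valid[of u v z w r] u w vj by blast
      next
        case False
        have "halts (Go (Read (ReadV None)), [(li, map Bit z2),
            ([Mark], map Bit w), ([Mark], map Val (uvals u)), ([Mark], []), ([Mark], [])])
          (2 * length v + 2) False" for li
        proof (cases "length v = 2 * length (uvals u)")
          case True
          then have "malformed j" using False vj(2) len_u by auto
          then show ?thesis unfolding vj(1)
            by (intro halts_read_v[OF True] halts_read_malformed) auto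
        next
          case False
          then show ?thesis using halts_read_v_mismatch[OF False vj(2)] by (simp add: vj(1))
        qed
        note * = halts_part_u[OF u(2) this, folded u(1)]
        have "2 * length u + (length w + length u + 4 + (2 * length v + 2)) \<le> 10 * length z + 20"
          by (simp add: w u vj)
        with * show ?thesis by (intro step_u) (rule halts_mono)
      qed
    qed
  qed
qed

text \<open>A name that outside the locale depends on the two flags only.\<close>

definition verified :: "bool list set" where
  "verified = language"

lemma verified_in_P: "verified \<in> class_P"
  unfolding verified_def using halts_any by (rule language_in_P)

lemma tuple_in_verified:
  assumes "even (length u)" "length v = length u"
  shows "tuple [w, u, v] \<in> verified \<longleftrightarrow> check w (merge (uvals u) v)"
proof -
  have "tuple [w, u, v] = double w @ False # True # double u @ False # True # double v @ False # True # []"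
    by (simp add: tuple_def double_def)
  from halts_language[OF halts_valid[OF assms this]] show ?thesis
    unfolding verified_def .
qed

end

section \<open>Evaluation of formulas and circuits\<close>

lemma seek_unary: "i < length A \<Longrightarrow> seek A (unary i @ ws) = Some (A ! i, ws)"
proof (induction i arbitrary: A)
  case 0
  then show ?case by (cases A) (auto simp: unary_def)
next
  case (Suc i)
  then show ?case by (cases A) (auto simp: unary_def)
qed

lemma seek_SomeD: "seek A ws = Some (v, ws') \<Longrightarrow> \<exists>i < length A. ws = unary i @ ws' \<and> v = A ! i"
proof (induction A ws rule: seek.induct)
  case (1 a A ws)
  then obtain i where "i < length A" "ws = unary i @ ws'" "v = A ! i" by auto
  then show ?case by (intro exI[of _ "Suc i"]) (simp add: unary_def)
next
  case (2 a A ws)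
  then show ?case by (intro exI[of _ 0]) (simp add: unary_def)
qed simp_all

definition formula_val :: "val list \<Rightarrow> formula \<Rightarrow> val" where
  "formula_val A f = (\<lambda>t. eval_formula f (map (\<lambda>v. v t) A))"

lemma formula_val_Var: "i < length A \<Longrightarrow> formula_val A (Var i) = A ! i"
  by (simp add: formula_val_def)

lemma formula_val_simps:
  "formula_val A (Const b) = (\<lambda>_. b)"
  "formula_val A (Neg f) = (\<lambda>t. \<not> formula_val A f t)"
  "formula_val A (Conj f g) = comb False (formula_val A f) (formula_val A g)"
  "formula_val A (Disj f g) = comb True (formula_val A f) (formula_val A g)"
  by (simp_all add: formula_val_def comb_def)

lemma run_sat_encode:
  "vars f \<subseteq> {..<length A} \<Longrightarrow>
    run_sat A (encode_formula f @ ws) st = run_sat A ws (formula_val A f # st)"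
  by (induction f arbitrary: ws st) (simp_all add: seek_unary formula_val_Var formula_val_simps)

text \<open>Invariant of the parser: the stack holds the values of formulas \<open>fs\<close>, and
  their codes, bottom of the stack first, are what has been read. At the end a single formula
  remains, so every accepted word is the code of a formula.\<close>

lemma run_sat_decode:
  assumes "run_sat A ws (map (formula_val A) fs)" "\<forall>f \<in> set fs. vars f \<subseteq> {..<length A}"
  shows "\<exists>f. concat (map encode_formula (rev fs)) @ ws = encode_formula f \<and>
    vars f \<subseteq> {..<length A} \<and> formula_val A f X1 \<and> formula_val A f X2"
  using assms
proof (induction A ws "map (formula_val A) fs" arbitrary: fs rule: run_sat.induct)
  case (1 A)
  then show ?case by (cases fs rule: remdups_adj.cases) auto
next
  case (2 A ws)
  from "2.prems"(1) obtain v ws' where s: "seek A ws = Some (v, ws')"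
    and r: "run_sat A ws' (v # map (formula_val A) fs)"
    by (auto split: option.splits)
  obtain i where i: "i < length A" "ws = unary i @ ws'" "v = A ! i"
    using seek_SomeD[OF s] by blast
  show ?case
    using "2.hyps"[OF s refl, of "Var i # fs"] r i "2.prems"(2) by (simp add: formula_val_Var)
next
  case (3 A b ws)
  show ?case
    using "3.hyps"[of "Const b # fs"] "3.prems" by (simp add: formula_val_simps)
next
  case (4 A ws)
  then obtain f fs' where fs: "fs = f # fs'" by (cases fs) auto
  show ?case
    using "4.hyps"[of "formula_val A f" "map (formula_val A) fs'" "Neg f # fs'"] "4.prems"
    by (simp add: fs formula_val_simps)
next
  case (5 A d ws)
  then obtain f g fs' where fs: "fs = g # f # fs'" by (cases fs rule: remdups_adj.cases) auto
  define h where "h = (if d then Disj f g else Conj f g)"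
  have h: "comb d (formula_val A f) (formula_val A g) = formula_val A h" "vars h = vars f \<union> vars g"
    "encode_formula h = encode_formula f @ encode_formula g @ [True, True, d]"
    by (simp_all add: h_def formula_val_simps)
  show ?case
    using "5.hyps"[of "formula_val A g" "formula_val A f # map (formula_val A) fs'"
        "formula_val A f" "map (formula_val A) fs'" "h # fs'"] "5.prems"
    by (simp add: fs h)
qed simp_all

lemma run_sat_iff:
  "run_sat A ws [] \<longleftrightarrow>
    (\<exists>f. ws = encode_formula f \<and> vars f \<subseteq> {..<length A} \<and> formula_val A f X1 \<and> formula_val A f X2)"
  using run_sat_decode[of A ws "[]"] run_sat_encode[of _ A "[]" "[]"] by auto

section \<open>Lexicographic comparison of outputs\<close>

lemma bin_val_Cons: "bin_val (b # bs) = of_bool b * 2 ^ length bs + bin_val bs"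
  by (simp add: bin_val_def horner_sum_append)

lemma bin_val_less: "bin_val bs < 2 ^ length bs"
  by (induction bs) (auto simp: bin_val_Cons, simp add: bin_val_def)

text \<open>The remaining bits contribute less than \<open>2 ^ length bs\<close>, so unequal leading
  bits decide.\<close>

lemma bin_val_Cons_le:
  assumes "length bs = length cs"
  shows "bin_val (b # bs) \<le> bin_val (c # cs) \<longleftrightarrow> \<not> b \<and> c \<or> (b \<longrightarrow> c) \<and> bin_val bs \<le> bin_val cs"
  using bin_val_less[of bs] bin_val_less[of cs] assms by (auto simp: bin_val_Cons)

text \<open>The flag \<open>c\<close> stays general for the induction: a track already ahead
  satisfies the comparison whatever the remaining bits are.\<close>

lemma run_outs_iff:
  "run_outs A ws n c \<longleftrightarrow> (\<exists>is. ws = concat (map unary is) \<and> length is = n \<and> set is \<subseteq> {..<length A} \<and>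
     (\<forall>t \<in> {X1, X2}. c t \<or> bin_val (map (\<lambda>i. (A ! i) X3) is) \<le> bin_val (map (\<lambda>i. (A ! i) t) is)))"
proof (induction A ws n c rule: run_outs.induct)
  case (1 A n c)
  show ?case
  proof
    assume "run_outs A [] n c"
    then show "\<exists>is. [] = concat (map unary is) \<and> length is = n \<and> set is \<subseteq> {..<length A} \<and>
     (\<forall>t \<in> {X1, X2}. c t \<or> bin_val (map (\<lambda>i. (A ! i) X3) is) \<le> bin_val (map (\<lambda>i. (A ! i) t) is))"
      by (intro exI[of _ "[]"]) simp
  qed (auto simp: unary_not_Nil)
next
  case (2 A b ws n c)
  let ?le = "\<lambda>t is. bin_val (map (\<lambda>i. (A ! i) X3) is) \<le> bin_val (map (\<lambda>i. (A ! i) t) is)"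
  show ?case (is "_ \<longleftrightarrow> ?rhs")
  proof (cases "seek A (b # ws)")
    case None
    have "\<not> ?rhs"
    proof
      assume ?rhs
      then obtain "is" where outs: "b # ws = concat (map unary is)" "set is \<subseteq> {..<length A}" by blast
      then obtain i is' where "is = i # is'" by (cases "is") auto
      then show False using outs seek_unary[of i A "concat (map unary is')"] None by simp
    qed
    then show ?thesis using None by simp
  next
    case (Some p)
    obtain v ws' where p: "p = (v, ws')" by fastforce
    obtain i where i: "i < length A" "b # ws = unary i @ ws'" "v = A ! i"
      using seek_SomeD Some p by blast
    have "?rhs \<longleftrightarrow> (\<exists>is'. ws' = concat (map unary is') \<and> Suc (length is') = n \<and>
        set is' \<subseteq> {..<length A} \<and> (\<forall>t \<in> {X1, X2}. c t \<or> ?le t (i # is')))"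
    proof
      assume ?rhs
      then obtain "is" where outs: "b # ws = concat (map unary is)" "length is = n"
        "set is \<subseteq> {..<length A}" "\<forall>t \<in> {X1, X2}. c t \<or> ?le t is" by blast
      then obtain j is' where "is": "is = j # is'" by (cases "is") auto
      then have "j = i" "ws' = concat (map unary is')" using outs(1) i(2) by simp_all
      then show "\<exists>is'. ws' = concat (map unary is') \<and> Suc (length is') = n \<and>
          set is' \<subseteq> {..<length A} \<and> (\<forall>t \<in> {X1, X2}. c t \<or> ?le t (i # is'))"
        using outs "is" by auto
    next
      assume "\<exists>is'. ws' = concat (map unary is') \<and> Suc (length is') = n \<and>
          set is' \<subseteq> {..<length A} \<and> (\<forall>t \<in> {X1, X2}. c t \<or> ?le t (i # is'))"
      then obtain is' where "ws' = concat (map unary is')" "Suc (length is') = n"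
          "set is' \<subseteq> {..<length A}" "\<forall>t \<in> {X1, X2}. c t \<or> ?le t (i # is')" by blast
      then show ?rhs using i by (intro exI[of _ "i # is'"]) simp
    qed
    also have "\<dots> \<longleftrightarrow> 0 < n \<and> (\<forall>t \<in> {X1, X2}. c t \<or> \<not> v X3 \<or> v t) \<and>
        (\<exists>is'. ws' = concat (map unary is') \<and> length is' = n - 1 \<and> set is' \<subseteq> {..<length A} \<and>
          (\<forall>t \<in> {X1, X2}. (c t \<or> v t \<and> \<not> v X3) \<or> ?le t is'))"
    proof -
      \<comment> \<open>One bit of the comparison: equal leading bits pass the question on, and a
        strict lead is absorbed into the new flag.\<close>
      have le: "c t \<or> ?le t (i # is') \<longleftrightarrow>
          (c t \<or> \<not> v X3 \<or> v t) \<and> ((c t \<or> v t \<and> \<not> v X3) \<or> ?le t is')" for t is'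
        by (auto simp: bin_val_Cons_le i(3))
      have pos: "Suc l = n \<longleftrightarrow> 0 < n \<and> l = n - 1" for l by auto
      have "(\<exists>x. E x \<and> (N \<and> M x) \<and> S x \<and> C \<and> D x) \<longleftrightarrow> N \<and> C \<and> (\<exists>x. E x \<and> M x \<and> S x \<and> D x)"
        for E M S D :: "nat list \<Rightarrow> bool" and N C
        by blast
      then show ?thesis unfolding le pos ball_conj_distrib .
    qed
    also have "\<dots> \<longleftrightarrow> run_outs A (b # ws) n c"
      unfolding run_outs.simps Some p option.case prod.case "2.IH"[OF Some p[symmetric]] ..
    finally show ?thesis ..
  qed
qed

section \<open>Gates and circuits\<close>

definition gate_val :: "val list \<Rightarrow> gate \<Rightarrow> val" where
  "gate_val A g = (\<lambda>t. eval_gate g (map (\<lambda>v. v t) A))"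

lemma run_gates_Cons:
  "run_gates A (True # ws) n \<longleftrightarrow> (\<exists>g ws'. ws = encode_gate g @ ws' \<and>
     gate_args g \<subseteq> {..<length A} \<and> run_gates (A @ [gate_val A g]) ws' n)"
proof
  assume r: "run_gates A (True # ws) n"
  then consider b ws' where "ws = False # False # b # ws'"
    | ws' where "ws = False # True # ws'" | d ws' where "ws = True # d # ws'"
    by (cases "(A, True # ws, n)" rule: run_gates.cases) auto
  then show "\<exists>g ws'. ws = encode_gate g @ ws' \<and>
     gate_args g \<subseteq> {..<length A} \<and> run_gates (A @ [gate_val A g]) ws' n"
  proof cases
    case (1 b ws')
    then show ?thesis using r
      by (intro exI[of _ "GConst b"] exI[of _ ws']) (simp add: gate_val_def)
  next
    case (2 ws')
    then obtain v ws'' where s: "seek A ws' = Some (v, ws'')" "run_gates (A @ [\<lambda>t. \<not> v t]) ws'' n"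
      using r by (auto split: option.splits)
    obtain i where "i < length A" "ws' = unary i @ ws''" "v = A ! i"
      using seek_SomeD[OF s(1)] by blast
    then show ?thesis using s 2
      by (intro exI[of _ "GNot i"] exI[of _ ws'']) (simp add: gate_val_def)
  next
    case (3 d ws')
    then obtain v ws1 v' ws2 where s: "seek A ws' = Some (v, ws1)" "seek A ws1 = Some (v', ws2)"
      "run_gates (A @ [comb d v v']) ws2 n"
      using r by (auto split: option.splits)
    obtain i j where "i < length A" "ws' = unary i @ ws1" "v = A ! i"
       "j < length A" "ws1 = unary j @ ws2" "v' = A ! j"
      using seek_SomeD[OF s(1)] seek_SomeD[OF s(2)] by blast
    then show ?thesis using s 3
      by (intro exI[of _ "if d then GOr i j else GAnd i j"] exI[of _ ws2])
        (cases d; simp add: gate_val_def comb_def)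
  qed
next
  assume "\<exists>g ws'. ws = encode_gate g @ ws' \<and>
     gate_args g \<subseteq> {..<length A} \<and> run_gates (A @ [gate_val A g]) ws' n"
  then obtain g ws' where "ws = encode_gate g @ ws'" "gate_args g \<subseteq> {..<length A}"
    "run_gates (A @ [gate_val A g]) ws' n" by blast
  then show "run_gates A (True # ws) n"
    by (cases g) (simp_all add: gate_val_def comb_def seek_unary)
qed

definition encode_body :: "circuit \<Rightarrow> bool list" where
  "encode_body C = concat (map (\<lambda>g. True # encode_gate g) (gates C)) @ [False] @
     concat (map unary (outputs C))"

lemma is_circuit_Nil: "is_circuit m k (Circuit [] is) \<longleftrightarrow> length is = k \<and> set is \<subseteq> {..<m}"
  by (simp add: is_circuit_def)

text \<open>Removing the first gate turns its wire into one more input with the same number, so no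
  other wire has to be renumbered.\<close>

lemma is_circuit_Cons:
  "is_circuit m k (Circuit (g # gs) is) \<longleftrightarrow> gate_args g \<subseteq> {..<m} \<and> is_circuit (Suc m) k (Circuit gs is)"
  by (auto simp: is_circuit_def All_less_Suc2)

lemma eval_circuit_Nil: "eval_circuit (Circuit [] is) a = map (\<lambda>i. a ! i) is"
  by (simp add: eval_circuit_def)

lemma eval_circuit_Cons:
  "eval_circuit (Circuit (g # gs) is) a = eval_circuit (Circuit gs is) (a @ [eval_gate g a])"
  by (simp add: eval_circuit_def)

text \<open>Induction on the length of the code with the table generalised: after one gate the rest
  encodes a circuit over the extended list of inputs.\<close>

lemma run_gates_iff:
  "run_gates A ws n \<longleftrightarrow> (\<exists>C. ws = encode_body C \<and> is_circuit (length A) n C \<and>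
     (\<forall>t \<in> {X1, X2}. circuit_val C (map (\<lambda>v. v X3) A) \<le> circuit_val C (map (\<lambda>v. v t) A)))"
proof -
  define le where "le A C \<longleftrightarrow>
    (\<forall>t \<in> {X1, X2}. circuit_val C (map (\<lambda>v. v X3) A) \<le> circuit_val C (map (\<lambda>v. v t) A))" for A C
  \<comment> \<open>The disjunct \<open>False\<close> is the initial flag of
    \<open>run_outs\<close>, so that the right-hand side matches \<open>run_outs_iff\<close>
    literally.\<close>
  have le_Nil: "le A (Circuit [] is) \<longleftrightarrow>
      (\<forall>t \<in> {X1, X2}. False \<or> bin_val (map (\<lambda>i. (A ! i) X3) is) \<le> bin_val (map (\<lambda>i. (A ! i) t) is))"
    if "set is \<subseteq> {..<length A}" for A "is"
  proof -
    have "map (\<lambda>i. map (\<lambda>v. v t) A ! i) is = map (\<lambda>i. (A ! i) t) is" for t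
      using that by auto
    then show ?thesis unfolding le_def circuit_val_def eval_circuit_Nil by (simp only: simp_thms)
  qed
  have le_Cons: "le (A @ [gate_val A g]) (Circuit gs is) \<longleftrightarrow> le A (Circuit (g # gs) is)" for A g gs "is"
    by (simp add: le_def circuit_val_def eval_circuit_Cons gate_val_def)
  have "run_gates A ws n \<longleftrightarrow> (\<exists>C. ws = encode_body C \<and> is_circuit (length A) n C \<and> le A C)"
  proof (induction "length ws" arbitrary: A ws rule: less_induct)
    case less
    consider "ws = []" | ws' where "ws = False # ws'" | ws' where "ws = True # ws'"
      by (cases ws) auto
    then show ?case
    proof cases
      case 1
      then show ?thesis by (simp add: encode_body_def)
    next
      case (2 ws')
      have body: "False # ws' = encode_body C \<longleftrightarrow>
          (\<exists>is. C = Circuit [] is \<and> ws' = concat (map unary is))" for C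
        by (cases C; cases "gates C") (auto simp: encode_body_def)
      have "run_gates A ws n \<longleftrightarrow> (\<exists>is. ws' = concat (map unary is) \<and>
          is_circuit (length A) n (Circuit [] is) \<and> le A (Circuit [] is))"
        unfolding 2 run_gates.simps run_outs_iff is_circuit_Nil conj_assoc
        by (intro ex_cong1 conj_cong refl le_Nil[symmetric])
      then show ?thesis
        unfolding 2 body by blast
    next
      case (3 ws')
      have body: "True # ws' = encode_body C \<longleftrightarrow>
          (\<exists>g gs is. C = Circuit (g # gs) is \<and> ws' = encode_gate g @ encode_body (Circuit gs is))" for C
        by (cases C; cases "gates C") (auto simp: encode_body_def)
      have IH: "run_gates (A @ [gate_val A g]) r n \<longleftrightarrow> (\<exists>C. r = encode_body C \<and>
          is_circuit (Suc (length A)) n C \<and> le (A @ [gate_val A g]) C)"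
        if "ws' = encode_gate g @ r" for g r
        using less[of r "A @ [gate_val A g]"] that 3 by simp
      have "run_gates A ws n \<longleftrightarrow> (\<exists>g r. ws' = encode_gate g @ r \<and> gate_args g \<subseteq> {..<length A} \<and>
          (\<exists>C. r = encode_body C \<and> is_circuit (Suc (length A)) n C \<and> le (A @ [gate_val A g]) C))"
        unfolding 3 run_gates_Cons by (intro ex_cong1 conj_cong refl IH)
      also have "\<dots> \<longleftrightarrow> (\<exists>g gs is. ws' = encode_gate g @ encode_body (Circuit gs is) \<and>
          is_circuit (length A) n (Circuit (g # gs) is) \<and> le A (Circuit (g # gs) is))"
        unfolding is_circuit_Cons le_Cons[symmetric] by (metis circuit.exhaust)
      also have "\<dots> \<longleftrightarrow> (\<exists>C. ws = encode_body C \<and> is_circuit (length A) n C \<and> le A C)"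
        unfolding 3 body by blast
      finally show ?thesis .
    qed
  qed
  then show ?thesis unfolding le_def .
qed

section \<open>Unique solutions\<close>

text \<open>The common matrix of both problems. It includes well-formedness of the instance, so a
  word that is no proper encoding has no solutions; for formulas x' is a dummy.\<close>

definition accepts :: "bool \<Rightarrow> nat \<Rightarrow> bool list \<Rightarrow> bool list \<Rightarrow> bool list \<Rightarrow> bool list \<Rightarrow> bool" where
  "accepts sat n ws x x' y \<longleftrightarrow>
     (if sat then \<exists>f. ws = encode_formula f \<and> vars f \<subseteq> {..<2 * n} \<and> eval_formula f (x @ y)
      else \<exists>C. ws = encode_body C \<and> is_circuit (2 * n) n C \<and>
        circuit_val C (x' @ y) \<le> circuit_val C (x @ y))"

lemma encode_body_inj: "encode_body C = encode_body D \<longleftrightarrow> C = D"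
  using encode_circuit_inj[of 0 C 0 D] by (simp add: encode_circuit_def encode_body_def)

definition track_bits :: "nat \<Rightarrow> val list \<Rightarrow> track \<Rightarrow> bool list" where
  "track_bits n qs t = map (\<lambda>q. q t) (take n qs)"

lemma run_iff:
  assumes "n \<le> length qs"
  shows "verifier.run sat (wires n qs) ws n \<longleftrightarrow>
    (\<forall>t \<in> {X1, X2}. accepts sat n ws (track_bits n qs t) (track_bits n qs X3) (track_bits n qs Y))"
proof -
  have bits: "map (\<lambda>v. v t) (wires n qs) = track_bits n qs t @ track_bits n qs Y" for t
    by (simp add: wires_def track_bits_def)
  have len: "length (wires n qs) = 2 * n"
    using assms by (simp add: wires_def)
  let ?x = "track_bits n qs" and ?z = "track_bits n qs X3" and ?y = "track_bits n qs Y"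
  show ?thesis
  proof (cases sat)
    case True
    have "run_sat (wires n qs) ws [] \<longleftrightarrow> (\<exists>f. ws = encode_formula f \<and> vars f \<subseteq> {..<2 * n} \<and>
        eval_formula f (?x X1 @ ?y) \<and> eval_formula f (?x X2 @ ?y))"
      unfolding run_sat_iff len formula_val_def bits ..
    \<comment> \<open>On the right each track has its own existential quantifier; injectivity of the
      encoding makes the two witnesses equal.\<close>
    also have "\<dots> \<longleftrightarrow> (\<forall>t \<in> {X1, X2}. accepts True n ws (?x t) ?z ?y)"
      by (auto simp: accepts_def inj_eq[OF encode_formula_inj])
    finally show ?thesis using True by (simp only: verifier.run_def if_True)
  next
    case False
    have "run_gates (wires n qs) ws n \<longleftrightarrow> (\<exists>C. ws = encode_body C \<and> is_circuit (2 * n) n C \<and>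
        (\<forall>t \<in> {X1, X2}. circuit_val C (?z @ ?y) \<le> circuit_val C (?x t @ ?y)))"
      unfolding run_gates_iff len bits ..
    also have "\<dots> \<longleftrightarrow> (\<forall>t \<in> {X1, X2}. accepts False n ws (?x t) ?z ?y)"
      by (auto simp: accepts_def encode_body_inj)
    finally show ?thesis using False by (simp only: verifier.run_def if_False)
  qed
qed

lemma check_iff:
  "verifier.check sat differ (unary n @ ws) qs \<longleftrightarrow> n \<le> length qs \<and>
     (differ \<longrightarrow> track_bits n qs X1 \<noteq> track_bits n qs X2) \<and>
     (\<forall>t \<in> {X1, X2}. accepts sat n ws (track_bits n qs t) (track_bits n qs X3) (track_bits n qs Y))"
proof -
  have "(\<exists>q \<in> set (take n qs). q X1 \<noteq> q X2) \<longleftrightarrow> track_bits n qs X1 \<noteq> track_bits n qs X2"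
    by (auto simp: track_bits_def)
  then show ?thesis
    by (simp add: verifier.check_unary run_iff cong: conj_cong)
qed

section \<open>Certificates of prescribed length\<close>

lemma length_pairs: "length (pairs u) = length u div 2"
  by (induction u rule: pairs.induct) auto

lemma pairs_surj: "\<exists>u. length u = 2 * length ps \<and> pairs u = ps"
proof (induction ps)
  case (Cons p ps)
  then obtain u where "length u = 2 * length ps" "pairs u = ps" by blast
  then show ?case by (intro exI[of _ "fst p # snd p # u"]) simp
qed simp

text \<open>Translates quantification over certificates of fixed length into quantification over
  pairs of words of length \<open>n\<close>.\<close>

lemma ex_pairs_prefix:
  assumes "n \<le> m"
  shows "(\<exists>u. length u = 2 * m \<and> P (map fst (take n (pairs u))) (map snd (take n (pairs u)))) \<longleftrightarrow>
    (\<exists>x y. length x = n \<and> length y = n \<and> P x y)"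
proof
  assume "\<exists>u. length u = 2 * m \<and> P (map fst (take n (pairs u))) (map snd (take n (pairs u)))"
  then obtain u where "length u = 2 * m" "P (map fst (take n (pairs u))) (map snd (take n (pairs u)))"
    by blast
  then show "\<exists>x y. length x = n \<and> length y = n \<and> P x y"
    using assms by (intro exI conjI) (auto simp: length_pairs)
next
  assume "\<exists>x y. length x = n \<and> length y = n \<and> P x y"
  then obtain x y where xy: "length x = n" "length y = n" "P x y" by blast
  \<comment> \<open>The certificate is padded with zeros behind the first \<open>n\<close>
    pairs.\<close>
  obtain u where u: "length u = 2 * length (zip x y @ replicate (m - n) (False, False))"
    "pairs u = zip x y @ replicate (m - n) (False, False)"
    using pairs_surj by blast
  then show "\<exists>u. length u = 2 * m \<and> P (map fst (take n (pairs u))) (map snd (take n (pairs u)))"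
    using xy assms by (intro exI[of _ u]) simp
qed

lemma all_pairs_prefix:
  assumes "n \<le> m"
  shows "(\<forall>u. length u = 2 * m \<longrightarrow> P (map fst (take n (pairs u))) (map snd (take n (pairs u)))) \<longleftrightarrow>
    (\<forall>x y. length x = n \<longrightarrow> length y = n \<longrightarrow> P x y)"
  using ex_pairs_prefix[OF assms, of "\<lambda>x y. \<not> P x y"] by blast

lemma track_bits_merge:
  assumes "even (length u)" "length v = length u"
  shows "track_bits n (merge (uvals u) v) X1 = map fst (take n (pairs u))"
    "track_bits n (merge (uvals u) v) X2 = map snd (take n (pairs u))"
    "track_bits n (merge (uvals u) v) X3 = map fst (take n (pairs v))"
    "track_bits n (merge (uvals u) v) Y = map snd (take n (pairs v))"
proof -
  have "length (pairs v) = length (pairs u)" using assms by (simp add: length_pairs)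
  then have "track_bits n (merge (uvals u) v) X1 = map fst (take n (pairs u)) \<and>
    track_bits n (merge (uvals u) v) X2 = map snd (take n (pairs u)) \<and>
    track_bits n (merge (uvals u) v) X3 = map fst (take n (pairs v)) \<and>
    track_bits n (merge (uvals u) v) Y = map snd (take n (pairs v))"
    unfolding track_bits_def merge_def uvals_def
    by (auto simp: take_map take_zip split_beta intro!: nth_equalityI)
  then show "track_bits n (merge (uvals u) v) X1 = map fst (take n (pairs u))"
    "track_bits n (merge (uvals u) v) X2 = map snd (take n (pairs u))"
    "track_bits n (merge (uvals u) v) X3 = map fst (take n (pairs v))"
    "track_bits n (merge (uvals u) v) Y = map snd (take n (pairs v))" by blast+
qed

definition solution :: "bool \<Rightarrow> nat \<Rightarrow> bool list \<Rightarrow> bool list \<Rightarrow> bool" where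
  "solution sat n ws x \<longleftrightarrow> length x = n \<and>
     (\<forall>x' y. length x' = n \<longrightarrow> length y = n \<longrightarrow> accepts sat n ws x x' y)"

text \<open>Without \<open>differ\<close> the candidates may coincide and this is mere existence;
  with it, uniqueness fails. The same two-candidate form in both cases lets one machine serve for
  both.\<close>

definition solvable :: "bool \<Rightarrow> bool \<Rightarrow> bool list set" where
  "solvable sat differ = {unary n @ ws | n ws. \<exists>x1 x2. (differ \<longrightarrow> x1 \<noteq> x2) \<and>
     solution sat n ws x1 \<and> solution sat n ws x2}"

lemma solvable_Sigma2P: "solvable sat differ \<in> Sigma2P"
proof -
  let ?K = "verifier.verified sat differ"
  \<comment> \<open>The factor 2 is due to interleaving: each certificate holds
    \<open>length w\<close> pairs, and \<open>n \<le> length w\<close> as \<open>w\<close> contains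
    \<open>n\<close> in unary.\<close>
  let ?p = "[:0, 2:] :: nat poly"
  have "w \<in> solvable sat differ \<longleftrightarrow>
      (\<exists>u. length u = 2 * length w \<and> (\<forall>v. length v = 2 * length w \<longrightarrow> tuple [w, u, v] \<in> ?K))"
    (is "_ \<longleftrightarrow> ?rhs") for w
  proof -
    have K: "tuple [w, u, v] \<in> ?K \<longleftrightarrow> verifier.check sat differ w (merge (uvals u) v)"
      if "length u = 2 * length w" "length v = 2 * length w" for u v
      using that by (intro verifier.tuple_in_verified) simp_all
    show ?thesis
    proof (cases w rule: unary_cases)
      case (1 n)
      then have "w \<noteq> unary m @ ws" for m ws
        using verifier.not_check_replicate
        by (metis Un_iff append_is_Nil_conv in_set_replicate list.set_intros(1) set_append unary_def)
      then have "w \<notin> solvable sat differ" by (auto simp: solvable_def)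
      \<comment> \<open>Some \<open>v\<close> of the required length exists, so the inner universal
        statement is not vacuous.\<close>
      moreover have "\<not> ?rhs"
        using K verifier.not_check_replicate[of sat differ n] 1
        by (metis length_replicate)
      ultimately show ?thesis by simp
    next
      case (2 n ws)
      have n: "n \<le> length w" by (simp add: 2 unary_def)
      have check: "tuple [w, u, v] \<in> ?K \<longleftrightarrow>
          (differ \<longrightarrow> map fst (take n (pairs u)) \<noteq> map snd (take n (pairs u))) \<and>
          (\<forall>x \<in> {map fst (take n (pairs u)), map snd (take n (pairs u))}.
             accepts sat n ws x (map fst (take n (pairs v))) (map snd (take n (pairs v))))"
        if "length u = 2 * length w" "length v = 2 * length w" for u v
        using K[OF that] that n
        by (simp add: 2 check_iff track_bits_merge length_merge length_uvals) 
          (auto simp: merge_def uvals_def length_pairs)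
      have "?rhs \<longleftrightarrow> (\<exists>u. length u = 2 * length w \<and> (\<forall>v. length v = 2 * length w \<longrightarrow>
          (differ \<longrightarrow> map fst (take n (pairs u)) \<noteq> map snd (take n (pairs u))) \<and>
          (\<forall>x \<in> {map fst (take n (pairs u)), map snd (take n (pairs u))}.
             accepts sat n ws x (map fst (take n (pairs v))) (map snd (take n (pairs v))))))"
        using check by blast
      also have "\<dots> \<longleftrightarrow> (\<exists>u. length u = 2 * length w \<and> (\<forall>x' y. length x' = n \<longrightarrow> length y = n \<longrightarrow>
          (differ \<longrightarrow> map fst (take n (pairs u)) \<noteq> map snd (take n (pairs u))) \<and>
          (\<forall>x \<in> {map fst (take n (pairs u)), map snd (take n (pairs u))}. accepts sat n ws x x' y)))"
        unfolding all_pairs_prefix[OF n, of "\<lambda>x' y.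
          (differ \<longrightarrow> map fst (take n (pairs u)) \<noteq> map snd (take n (pairs u))) \<and>
          (\<forall>x \<in> {map fst (take n (pairs u)), map snd (take n (pairs u))}. accepts sat n ws x x' y)" for u] ..
      also have "\<dots> \<longleftrightarrow> (\<exists>x1 x2. length x1 = n \<and> length x2 = n \<and>
          (\<forall>x' y. length x' = n \<longrightarrow> length y = n \<longrightarrow>
            (differ \<longrightarrow> x1 \<noteq> x2) \<and> (\<forall>x \<in> {x1, x2}. accepts sat n ws x x' y)))"
        using ex_pairs_prefix[OF n, of "\<lambda>x1 x2. \<forall>x' y. length x' = n \<longrightarrow> length y = n \<longrightarrow>
            (differ \<longrightarrow> x1 \<noteq> x2) \<and> (\<forall>x \<in> {x1, x2}. accepts sat n ws x x' y)"] .
      also have "\<dots> \<longleftrightarrow> (\<exists>x1 x2. (differ \<longrightarrow> x1 \<noteq> x2) \<and> solution sat n ws x1 \<and> solution sat n ws x2)"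
        \<comment> \<open>The word \<open>replicate n False\<close> shows that the ranges of x' and
          y are nonempty; hence the condition \<open>differ \<longrightarrow> x1 \<noteq> x2\<close>
          can be moved out of their scope.\<close>
        unfolding solution_def using length_replicate[of n False] by blast
      also have "\<dots> \<longleftrightarrow> w \<in> solvable sat differ"
        by (auto simp: solvable_def 2)
      finally show ?thesis by blast
    qed
  qed
  then show ?thesis
    unfolding Sigma2P_def
    by (intro CollectI bexI[OF _ verifier.verified_in_P[of sat differ]] exI[of _ ?p]) (simp add: mult.commute)
qed

lemma mem_unary_append_iff: "unary n @ ws \<in> {unary n @ ws | n ws. P n ws} \<longleftrightarrow> P n ws"
  by auto

lemma unique_solution_D2P: "{unary n @ ws | n ws. \<exists>!x. solution sat n ws x} \<in> D2P"
proof -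
  have "w \<in> {unary n @ ws | n ws. \<exists>!x. solution sat n ws x} \<longleftrightarrow>
      w \<in> solvable sat False \<inter> - solvable sat True" for w
  proof (cases "\<exists>n ws. w = unary n @ ws")
    case True
    then obtain n ws where w: "w = unary n @ ws" by blast
    have "(\<exists>!x. S x) \<longleftrightarrow> (\<exists>x1 x2. (False \<longrightarrow> x1 \<noteq> x2) \<and> S x1 \<and> S x2) \<and>
        \<not> (\<exists>x1 x2. (True \<longrightarrow> x1 \<noteq> x2) \<and> S x1 \<and> S x2)" for S :: "bool list \<Rightarrow> bool"
      by blast
    then show ?thesis
      unfolding w solvable_def Int_iff Compl_iff mem_unary_append_iff .
  next
    case False
    then show ?thesis by (auto simp: solvable_def)
  qed
  then have "{unary n @ ws | n ws. \<exists>!x. solution sat n ws x} = solvable sat False \<inter> - solvable sat True"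
    by (rule set_eqI)
  moreover have "- solvable sat True \<in> Pi2P"
    by (simp add: Pi2P_def solvable_Sigma2P)
  ultimately show ?thesis
    unfolding D2P_def using solvable_Sigma2P[of sat False] by blast
qed

section \<open>The two problems as questions about unique solutions\<close>

lemma UEA_Sat_eq: "UEA_Sat = {unary n @ ws | n ws. \<exists>!x. solution True n ws x}"
proof -
  have acc: "accepts True n (encode_formula f) x x' y \<longleftrightarrow> vars f \<subseteq> {..<2 * n} \<and> eval_formula f (x @ y)"
    for n f x x' y
    using injD[OF encode_formula_inj] by (auto simp: accepts_def)
  have sol: "solution True n (encode_formula f) x \<longleftrightarrow> vars f \<subseteq> {..<2 * n} \<and> length x = n \<and>
      (\<forall>y. length y = n \<longrightarrow> eval_formula f (x @ y))" for n f x
    unfolding solution_def acc using length_replicate[of n False] by blast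
  have enc: "\<exists>f. ws = encode_formula f" if "solution True n ws x" for n ws x
    using that length_replicate[of n False] by (auto simp: solution_def accepts_def)
  \<comment> \<open>If a variable is out of range, no \<open>x\<close> is a solution and both sides
    are false; otherwise the two predicates agree.\<close>
  have eq: "(\<exists>!x. solution True n (encode_formula f) x) \<longleftrightarrow> vars f \<subseteq> {..<2 * n} \<and>
      (\<exists>!x. length x = n \<and> (\<forall>y. length y = n \<longrightarrow> eval_formula f (x @ y)))" for n f
    by (cases "vars f \<subseteq> {..<2 * n}") (simp_all add: sol, blast)
  show ?thesis
  proof (intro equalityI subsetI)
    fix w assume "w \<in> UEA_Sat"
    then show "w \<in> {unary n @ ws | n ws. \<exists>!x. solution True n ws x}"
      unfolding UEA_Sat_def encode_sat_instance_def eq[symmetric] by blast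
  next
    fix w assume "w \<in> {unary n @ ws | n ws. \<exists>!x. solution True n ws x}"
    then obtain n ws where w: "w = unary n @ ws" "\<exists>!x. solution True n ws x" by blast
    then obtain f where "ws = encode_formula f" using enc by blast
    then show "w \<in> UEA_Sat"
      unfolding UEA_Sat_def encode_sat_instance_def eq[symmetric] using w by blast
  qed
qed

text \<open>
  A weakly dominant strategy is the only one that is nowhere worse than any other: a second one
  would be nowhere worse than the first, which therefore could not be strictly better anywhere.
\<close>

lemma weakly_dominant_iff_unique:
  fixes c :: "'a \<Rightarrow> 'b \<Rightarrow> nat"
  assumes "y0 \<in> B"
  shows "(\<exists>x. x \<in> A \<and> (\<forall>x' y. x' \<in> A \<and> y \<in> B \<and> x' \<noteq> x \<longrightarrow>
        (\<exists>y'. y' \<in> B \<and> c x y \<ge> c x' y \<and> c x y' > c x' y'))) \<longleftrightarrow>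
    (\<exists>!x. x \<in> A \<and> (\<forall>x' y. x' \<in> A \<longrightarrow> y \<in> B \<longrightarrow> c x' y \<le> c x y))" (is "?l \<longleftrightarrow> ?r")
proof
  assume ?l
  then obtain x where x: "x \<in> A" "\<And>x' y. x' \<in> A \<Longrightarrow> y \<in> B \<Longrightarrow> x' \<noteq> x \<Longrightarrow>
      c x' y \<le> c x y \<and> (\<exists>y'. y' \<in> B \<and> c x' y' < c x y')"
    by blast
  show ?r
  proof (rule ex1I[of _ x])
    show "x \<in> A \<and> (\<forall>x' y. x' \<in> A \<longrightarrow> y \<in> B \<longrightarrow> c x' y \<le> c x y)"
      using x by blast
    \<comment> \<open>For \<open>z \<noteq> x\<close> the assumption at \<open>y0\<close> provides
      some y' at which \<open>z\<close> is strictly worse than \<open>x\<close>, although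
      \<open>z\<close> is nowhere worse.\<close>
    show "z = x" if "z \<in> A \<and> (\<forall>x' y. x' \<in> A \<longrightarrow> y \<in> B \<longrightarrow> c x' y \<le> c z y)" for z
      using that x(1) x(2)[of z y0] assms by (meson linorder_not_le)
  qed
next
  assume ?r
  then obtain x where x: "x \<in> A" "\<And>x' y. x' \<in> A \<Longrightarrow> y \<in> B \<Longrightarrow> c x' y \<le> c x y"
    and unique: "\<And>z. z \<in> A \<and> (\<forall>x' y. x' \<in> A \<longrightarrow> y \<in> B \<longrightarrow> c x' y \<le> c z y) \<Longrightarrow> z = x"
    by blast
  \<comment> \<open>Were \<open>z\<close> nowhere strictly worse than \<open>x\<close>, then by
    transitivity through \<open>x\<close> it would be nowhere worse than any other strategy,
    contradicting uniqueness.\<close>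
  have "\<exists>y'. y' \<in> B \<and> c z y' < c x y'" if "z \<in> A" "z \<noteq> x" for z
    using unique[of z] that x by (meson le_trans linorder_not_le)
  then show ?l using x by blast
qed

lemma WDom_Strategy_eq: "WDom_Strategy = {unary n @ ws | n ws. \<exists>!x. solution False n ws x}"
proof -
  have acc: "accepts False n (encode_body C) x x' y \<longleftrightarrow>
      is_circuit (2 * n) n C \<and> circuit_val C (x' @ y) \<le> circuit_val C (x @ y)" for n C x x' y
    by (auto simp: accepts_def encode_body_inj)
  have sol: "solution False n (encode_body C) x \<longleftrightarrow> is_circuit (2 * n) n C \<and> length x = n \<and>
      (\<forall>x' y. length x' = n \<longrightarrow> length y = n \<longrightarrow> circuit_val C (x' @ y) \<le> circuit_val C (x @ y))" for n C x
    unfolding solution_def acc using length_replicate[of n False] by blast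
  have enc: "\<exists>C. ws = encode_body C" if "solution False n ws x" for n ws x
    using that length_replicate[of n False] by (auto simp: solution_def accepts_def)
  have dominant: "(\<exists>x. length x = n \<and>
       (\<forall>x' y. length x' = n \<and> length y = n \<and> x' \<noteq> x \<longrightarrow>
         (\<exists>y'. length y' = n \<and>
            circuit_val C (x @ y) \<ge> circuit_val C (x' @ y) \<and>
            circuit_val C (x @ y') > circuit_val C (x' @ y')))) \<longleftrightarrow>
      (\<exists>!x. length x = n \<and>
        (\<forall>x' y. length x' = n \<longrightarrow> length y = n \<longrightarrow> circuit_val C (x' @ y) \<le> circuit_val C (x @ y)))"
    for n C
    by (rule weakly_dominant_iff_unique[of "replicate n False" "{y. length y = n}" "{x. length x = n}"
        "\<lambda>x y. circuit_val C (x @ y)", unfolded mem_Collect_eq]) simp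
  have body: "encode_circuit n C = unary n @ encode_body C" for n C
    by (simp add: encode_circuit_def encode_body_def)
  have eq: "(\<exists>!x. solution False n (encode_body C) x) \<longleftrightarrow> is_circuit (2 * n) n C \<and>
      (\<exists>!x. length x = n \<and>
        (\<forall>x' y. length x' = n \<longrightarrow> length y = n \<longrightarrow> circuit_val C (x' @ y) \<le> circuit_val C (x @ y)))"
    for n C
    by (cases "is_circuit (2 * n) n C") (simp_all add: sol, blast)
  show ?thesis
  proof (intro equalityI subsetI)
    fix w assume "w \<in> WDom_Strategy"
    then show "w \<in> {unary n @ ws | n ws. \<exists>!x. solution False n ws x}"
      unfolding WDom_Strategy_def dominant body eq[symmetric] by blast
  next
    fix w assume "w \<in> {unary n @ ws | n ws. \<exists>!x. solution False n ws x}"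
    then obtain n ws where w: "w = unary n @ ws" "\<exists>!x. solution False n ws x" by blast
    then obtain C where "ws = encode_body C" using enc by blast
    then show "w \<in> WDom_Strategy"
      unfolding WDom_Strategy_def dominant body eq[symmetric] using w by blast
  qed
qed

theorem theorem8p3: "UEA_Sat \<in> D2P \<and> WDom_Strategy \<in> D2P"
  by (simp add: UEA_Sat_eq WDom_Strategy_eq unique_solution_D2P)

end
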